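(* Suppose Assumptions 1–7 hold. Then there exist constants $\delta>0$ and $\varepsilon>0$ such that if $d^2\log d\le\varepsilon N$, then choosing $\lambda=\delta\sqrt{\log(d+1)/N}$ in the penalized pseudolikelihood problem, the estimator $(\hat\beta,\hat{\bm\theta})$ satisfies $\|(\hat\beta-\beta,\hat{\bm\theta}^\top-\bm\theta^\top)\|_2=O\big(\sqrt{\log d/N}\big)$ with probability $1-o(1)$ as $N\to\infty$ and $d\to\infty$.
   Context: Given covariates $\bm Z_1,\dots,\bm Z_N\in\mathbb R^d$, a symmetric $N\times N$ matrix $\bm A$, $\beta\in\mathbb R$ and $\bm\theta\in\mathbb R^d$, the model is $\mathbb P_{\beta,\bm\theta}(\bm X=\bm x)\propto\exp\big(\bm\theta^\top\sum_{i=1}^Nx_i\bm Z_i+\frac\beta2\bm x^\top\bm A\bm x\big)$, $\bm x\in\{-1,1\}^N$. With $m_i(\bm X)=\sum_jA_{ij}X_j$, define $L_N(\tilde\beta,\tilde{\bm\theta})=\log2-\frac1N\sum_{i=1}^N\big[X_i(\tilde\beta m_i(\bm X)+\tilde{\bm\theta}^\top\bm Z_i)-\log\cosh(\tilde\beta m_i(\bm X)+\tilde{\bm\theta}^\top\bm Z_i)\big]$ and $(\hat\beta,\hat{\bm\theta})\in\arg\min_{(\tilde\beta,\tilde{\bm\theta})\in\mathbb R^{d+1}}L_N(\tilde\beta,\tilde{\bm\theta})+\lambda\|(\tilde\beta,\tilde{\bm\theta})\|_1$. Norms: $\|\bm M\|_\infty=\max_i\sum_j|M_{ij}|$, $\|\bm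 M\|_F$ Frobenius, $\|\bm a\|_0$ number of nonzero entries. Assumptions: (1) $\|\bm\theta\|_\infty<\Theta$ and $\|\bm Z_i\|_\infty<M$ for all $i$, for fixed constants $\Theta,M>0$; (2) $\bm A$ is symmetric with zero diagonal; (3) $\sup_N\|\bm A\|_\infty\le1$; (4) $\liminf_{N\to\infty}\frac1N\|\bm A\|_F^2>0$; (5) $|\beta|<1/4$; (6) $\liminf_{N\to\infty}\lambda_{\min}(N^{-1}\mathbf Z^\top\mathbf Z)>0$, where $\mathbf Z=(\bm Z_1,\dots,\bm Z_N)^\top$; (7) $s=\|(\beta,\bm\theta^\top)\|_0$ is bounded in $N$ and $d$. Here $\bm A$, $\bm Z_i$ and $d$ may depend on $N$. *)

theory Defs
  imports Complex_Main "Jordan_Normal_Form.Char_Poly"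
begin

(* Conventions.  For sample size N and dimension d:
   - a spin configuration x is a function nat => real with x i \<in> {-1,1} for i < N and x i = 0 for i \<ge> N;
   - the interaction matrix is A :: nat => nat => real, only entries with i,j < N matter;
   - covariates: Z i k is the k-th coordinate of Z_i (i < N, k < d);
   - a parameter vector theta \<in> R^d is a function nat => real, coordinates k < d. *)

definition spins :: "nat \<Rightarrow> (nat \<Rightarrow> real) set" where
  "spins N = {x. (\<forall>i<N. x i = 1 \<or> x i = -1) \<and> (\<forall>i\<ge>N. x i = 0)}"

definition supported :: "nat \<Rightarrow> (nat \<Rightarrow> real) \<Rightarrow> bool" where
  "supported d t \<longleftrightarrow> (\<forall>k\<ge>d. t k = 0)"

definition ising_weight ::
  "nat \<Rightarrow> nat \<Rightarrow> (nat \<Rightarrow> nat \<Rightarrow> real) \<Rightarrow> (nat \<Rightarrow> nat \<Rightarrow> real) \<Rightarrow> real \<Rightarrow> (nat \<Rightarrow> real)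
    \<Rightarrow> (nat \<Rightarrow> real) \<Rightarrow> real" where
  "ising_weight N d A Z \<beta> \<theta> x =
     exp ((\<Sum>k<d. \<theta> k * (\<Sum>i<N. x i * Z i k))
          + \<beta> / 2 * (\<Sum>i<N. \<Sum>j<N. x i * A i j * x j))"

definition ising_prob ::
  "nat \<Rightarrow> nat \<Rightarrow> (nat \<Rightarrow> nat \<Rightarrow> real) \<Rightarrow> (nat \<Rightarrow> nat \<Rightarrow> real) \<Rightarrow> real \<Rightarrow> (nat \<Rightarrow> real)
    \<Rightarrow> (nat \<Rightarrow> real) set \<Rightarrow> real" where
  "ising_prob N d A Z \<beta> \<theta> E =
     (\<Sum>x\<in>spins N \<inter> E. ising_weight N d A Z \<beta> \<theta> x) / (\<Sum>x\<in>spins N. ising_weight N d A Z \<beta> \<theta> x)"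

definition local_field :: "nat \<Rightarrow> (nat \<Rightarrow> nat \<Rightarrow> real) \<Rightarrow> (nat \<Rightarrow> real) \<Rightarrow> nat \<Rightarrow> real" where
  "local_field N A x i = (\<Sum>j<N. A i j * x j)"

definition pl_loss ::
  "nat \<Rightarrow> nat \<Rightarrow> (nat \<Rightarrow> nat \<Rightarrow> real) \<Rightarrow> (nat \<Rightarrow> nat \<Rightarrow> real) \<Rightarrow> (nat \<Rightarrow> real)
    \<Rightarrow> real \<Rightarrow> (nat \<Rightarrow> real) \<Rightarrow> real" where
  "pl_loss N d A Z x b t =
     ln 2 - (1 / real N) * (\<Sum>i<N.
        x i * (b * local_field N A x i + (\<Sum>k<d. t k * Z i k))
        - ln (cosh (b * local_field N A x i + (\<Sum>k<d. t k * Z i k))))"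

definition l1_norm :: "nat \<Rightarrow> real \<Rightarrow> (nat \<Rightarrow> real) \<Rightarrow> real" where
  "l1_norm d b t = \<bar>b\<bar> + (\<Sum>k<d. \<bar>t k\<bar>)"

definition pl_objective ::
  "nat \<Rightarrow> nat \<Rightarrow> (nat \<Rightarrow> nat \<Rightarrow> real) \<Rightarrow> (nat \<Rightarrow> nat \<Rightarrow> real) \<Rightarrow> real \<Rightarrow> (nat \<Rightarrow> real)
    \<Rightarrow> real \<Rightarrow> (nat \<Rightarrow> real) \<Rightarrow> real" where
  "pl_objective N d A Z lam x b t = pl_loss N d A Z x b t + lam * l1_norm d b t"

definition is_pl_minimizer ::
  "nat \<Rightarrow> nat \<Rightarrow> (nat \<Rightarrow> nat \<Rightarrow> real) \<Rightarrow> (nat \<Rightarrow> nat \<Rightarrow> real) \<Rightarrow> real \<Rightarrow> (nat \<Rightarrow> real)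
    \<Rightarrow> real \<times> (nat \<Rightarrow> real) \<Rightarrow> bool" where
  "is_pl_minimizer N d A Z lam x bt \<longleftrightarrow>
     supported d (snd bt) \<and>
     (\<forall>b' t'. supported d t' \<longrightarrow>
        pl_objective N d A Z lam x (fst bt) (snd bt) \<le> pl_objective N d A Z lam x b' t')"

definition l2_dist :: "nat \<Rightarrow> real \<times> (nat \<Rightarrow> real) \<Rightarrow> real \<Rightarrow> (nat \<Rightarrow> real) \<Rightarrow> real" where
  "l2_dist d bt b0 t0 = sqrt ((fst bt - b0)\<^sup>2 + (\<Sum>k<d. (snd bt k - t0 k)\<^sup>2))"

definition l0_norm :: "nat \<Rightarrow> real \<Rightarrow> (nat \<Rightarrow> real) \<Rightarrow> nat" where
  "l0_norm d b t = (if b \<noteq> 0 then 1 else 0) + card {k. k < d \<and> t k \<noteq> 0}"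

definition gram :: "nat \<Rightarrow> nat \<Rightarrow> (nat \<Rightarrow> nat \<Rightarrow> real) \<Rightarrow> real mat" where
  "gram N d Z = mat d d (\<lambda>(k, l). (\<Sum>i<N. Z i k * Z i l) / real N)"

end

theory Submission
  imports Defs "HOL-Analysis.Function_Topology" "HOL-Analysis.L2_Norm"
begin

text \<open>
  Write \<open>\<eta>\<^sub>i = \<beta> m\<^sub>i + \<theta>\<^sup>T Z\<^sub>i\<close> and \<open>r\<^sub>i = x\<^sub>i - tanh \<eta>\<^sub>i\<close>. Flipping the spin \<open>x\<^sub>i\<close> changes the sign of
  \<open>r\<^sub>i\<close> times the weight of \<open>x\<close>, so by the method of exchangeable pairs every statistic
  \<open>\<Sum>\<^sub>i (a\<^sub>i + (B x)\<^sub>i) r\<^sub>i\<close> with bounded \<open>a\<close> and \<open>B\<close> of zero diagonal is subgaussian at scale \<open>\<surd>N\<close>.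
  Applied to \<open>B = A\<close> and \<open>a = Z\<^sub>k\<close>, this bounds the gradient of the loss at the true parameter by \<open>\<lambda>/2\<close>.

  For the curvature one needs \<open>\<parallel>u A x + Z v\<parallel>\<^sup>2 \<ge> c N (u\<^sup>2 + \<parallel>v\<parallel>\<^sup>2)\<close> on the cone of the lasso. Since
  \<open>\<parallel>A r\<parallel> \<le> 2 \<surd>N\<close>, it suffices to pair the vector with \<open>A r\<close>: \<open>\<langle>Z\<^sub>k, A r\<rangle>\<close> and the off-diagonal part of
  \<open>\<langle>A x, A r\<rangle>\<close> are again such statistics, hence \<open>o(N)\<close>, whereas the diagonal part
  \<open>\<Sum>\<^sub>i (A\<^sup>2)\<^sub>i\<^sub>i x\<^sub>i r\<^sub>i\<close> is at least a multiple of the squared Frobenius norm, because \<open>x\<^sub>i r\<^sub>i \<ge> 1 - tanh \<bar>\<eta>\<^sub>i\<bar>\<close>.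
  This bounds \<open>|u|\<close>, and the eigenvalue condition on the covariates then bounds \<open>\<parallel>v\<parallel>\<close>.
\<close>

section \<open>Scalar inequalities\<close>

lemma tanh_abs_diff_le: "\<bar>tanh a - tanh b\<bar> \<le> \<bar>a - b\<bar>" for a b :: real
proof -
  have *: "tanh b - tanh a \<le> b - a" if "a \<le> b" for a b :: real
  proof -
    have "\<exists>y. ((\<lambda>x. x - tanh x) has_real_derivative y) (at x) \<and> 0 \<le> y" for x :: real
      by (rule exI[of _ "tanh x ^ 2"]) (auto intro!: derivative_eq_intros)
    then have "a - tanh a \<le> b - tanh b"
      using that by (intro DERIV_nonneg_imp_nondecreasing[where f = "\<lambda>x. x - tanh x"]) auto
    then show ?thesis by simp
  qed
  show ?thesis
    using *[of a b] *[of b a] tanh_real_le_iff[of a b] tanh_real_le_iff[of b a] by linarith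
qed

text \<open>Comes from \<open>1 + y \<le> exp y\<close>. The bound is symmetric in \<open>a\<close>
  and \<open>b\<close> so that in \<open>tilted_sum_le\<close> the exponential at the flipped
  configuration can be folded back onto the unflipped one.\<close>

lemma exp_abs_diff_le: "\<bar>exp a - exp b\<bar> \<le> \<bar>a - b\<bar> * (exp a + exp b)" for a b :: real
proof -
  have *: "exp b - exp a \<le> (b - a) * (exp a + exp b)" if "a \<le> b" for a b :: real
  proof -
    have "1 - (b - a) \<le> exp (a - b)"
      using exp_ge_add_one_self[of "a - b"] by linarith
    then have "exp b * (1 - (b - a)) \<le> exp b * exp (a - b)"
      by (intro mult_left_mono) auto
    also have "\<dots> = exp a" by (simp flip: exp_add)
    finally have "exp b - exp a \<le> (b - a) * exp b" by (simp add: algebra_simps)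
    also have "\<dots> \<le> (b - a) * (exp a + exp b)"
      using that by (intro mult_left_mono) auto
    finally show ?thesis .
  qed
  show ?thesis
  proof (cases "a \<le> b")
    case True
    then show ?thesis using *[of a b] by simp
  next
    case False
    then show ?thesis using *[of b a] by (simp add: add.commute)
  qed
qed

lemma tanh_abs_mono:
  fixes x y :: real
  assumes "\<bar>x\<bar> \<le> y"
  shows "\<bar>tanh x\<bar> \<le> tanh y"
  by (metis assms tanh_real_abs tanh_real_le_iff)

text \<open>The derivative \<open>1 - tanh\<^sup>2\<close> of tanh is at least the constant on the
  interval from \<open>- (K + 1)\<close> to \<open>K + 1\<close>, which covers steps
  \<open>s\<close> up to 1. Longer steps only use monotonicity, hence the minimum.\<close>

lemma tanh_increment_ge:
  fixes K \<eta> s :: real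
  assumes "\<bar>\<eta>\<bar> \<le> K" "s \<ge> 0"
  shows "(1 - (tanh (K + 1))\<^sup>2) * min s 1 \<le> tanh (\<eta> + s) - tanh \<eta>"
proof -
  define c where "c = 1 - (tanh (K + 1))\<^sup>2"
  have *: "c * s \<le> tanh (\<eta> + s) - tanh \<eta>" if s: "0 \<le> s" "s \<le> 1" for s
  proof -
    have "tanh (\<eta> + 0) - c * 0 \<le> tanh (\<eta> + s) - c * s"
    proof (rule DERIV_nonneg_imp_nondecreasing[OF s(1)])
      fix u assume u: "0 \<le> u" "u \<le> s"
      have "((\<lambda>u. tanh (\<eta> + u) - c * u) has_real_derivative (1 - (tanh (\<eta> + u))\<^sup>2) - c) (at u)"
        by (auto intro!: derivative_eq_intros)
      moreover have "\<bar>tanh (\<eta> + u)\<bar> \<le> tanh (K + 1)"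
        using assms u s by (intro tanh_abs_mono) auto
      then have "(tanh (\<eta> + u))\<^sup>2 \<le> (tanh (K + 1))\<^sup>2"
        by (metis abs_ge_zero power2_abs power_mono)
      then have "(1 - (tanh (\<eta> + u))\<^sup>2) - c \<ge> 0" by (simp add: c_def)
      ultimately show "\<exists>y. ((\<lambda>u. tanh (\<eta> + u) - c * u) has_real_derivative y) (at u) \<and> 0 \<le> y"
        by blast
    qed
    then show ?thesis by simp
  qed
  show ?thesis
  proof (cases "s \<le> 1")
    case True
    then show ?thesis using *[of s] assms by (simp add: c_def)
  next
    case False
    then have "tanh (\<eta> + 1) \<le> tanh (\<eta> + s)" by simp
    moreover have "c \<le> tanh (\<eta> + 1) - tanh \<eta>" using *[of 1] by simp
    ultimately show ?thesis
      using False by (simp add: c_def min_def del: tanh_real_le_iff)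
  qed
qed

text \<open>Quantifies the convexity of \<open>ln cosh\<close> without any bound on \<delta>:
  quadratic growth for small \<delta>, linear growth for large \<delta>. For \<delta> \<ge> 0 the
  derivatives of both sides are compared through \<open>tanh_increment_ge\<close>; negative \<delta>
  reduces to this case because cosh is even.\<close>

lemma ln_cosh_remainder_ge:
  fixes K \<eta> \<delta> :: real
  assumes "\<bar>\<eta>\<bar> \<le> K"
  shows "(1 - (tanh (K + 1))\<^sup>2) / 2 * (\<delta>\<^sup>2 / (1 + \<bar>\<delta>\<bar>))
     \<le> ln (cosh (\<eta> + \<delta>)) - ln (cosh \<eta>) - tanh \<eta> * \<delta>"
proof -
  define c where "c = 1 - (tanh (K + 1))\<^sup>2"
  have "\<bar>tanh (K + 1)\<bar> < 1"
    using tanh_real_bounds[of "K + 1"] by auto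
  then have c: "c \<ge> 0"
    by (simp add: c_def abs_square_le_1)
  have *: "c / 2 * (\<delta>\<^sup>2 / (1 + \<delta>)) \<le> ln (cosh (\<eta> + \<delta>)) - ln (cosh \<eta>) - tanh \<eta> * \<delta>"
    if \<eta>: "\<bar>\<eta>\<bar> \<le> K" and \<delta>: "\<delta> \<ge> 0" for \<eta> \<delta> :: real
  proof -
    let ?g = "\<lambda>s. ln (cosh (\<eta> + s)) - tanh \<eta> * s - c / 2 * (s\<^sup>2 / (1 + s))"
    have "?g 0 \<le> ?g \<delta>"
    proof (rule DERIV_nonneg_imp_nondecreasing[OF \<delta>])
      fix s assume s: "0 \<le> s" "s \<le> \<delta>"
      \<comment> \<open>\<open>?q\<close> is the derivative of \<open>s\<^sup>2 / (1 + s)\<close>.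
        It is at most \<open>2 * min s 1\<close>, which matches the lower bound on the increment of
        tanh.\<close>
      let ?q = "(2 * s * (1 + s) - s\<^sup>2) / (1 + s)\<^sup>2"
      have "((\<lambda>s. s\<^sup>2 / (1 + s)) has_real_derivative ?q) (at s)"
        using s by (auto intro!: derivative_eq_intros simp: power2_eq_square)
      then have d1: "((\<lambda>s. c / 2 * (s\<^sup>2 / (1 + s))) has_real_derivative c / 2 * ?q) (at s)"
        by (rule DERIV_cmult)
      have d2: "((\<lambda>s. ln (cosh (\<eta> + s)) - tanh \<eta> * s) has_real_derivative tanh (\<eta> + s) - tanh \<eta>) (at s)"
        by (auto intro!: derivative_eq_intros simp: tanh_def)
      have "(?g has_real_derivative (tanh (\<eta> + s) - tanh \<eta> - c / 2 * ?q)) (at s)"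
        by (rule DERIV_diff[OF d2 d1])
      moreover have "?q \<le> 2 * min s 1"
      proof -
        have "2 * s * (1 + s) - s\<^sup>2 \<le> 2 * s * (1 + s)\<^sup>2"
          using s by (simp add: power2_eq_square algebra_simps)
        moreover have "2 * s * (1 + s) - s\<^sup>2 \<le> 2 * 1 * (1 + s)\<^sup>2"
          using s by (simp add: power2_eq_square algebra_simps)
        ultimately show ?thesis
          using s by (simp add: pos_divide_le_eq min_def)
      qed
      then have "c / 2 * ?q \<le> c / 2 * (2 * min s 1)"
        using c by (intro mult_left_mono) auto
      then have "tanh (\<eta> + s) - tanh \<eta> - c / 2 * ?q \<ge> 0"
        using tanh_increment_ge[OF \<eta> s(1)] by (simp add: c_def)
      ultimately show "\<exists>y. (?g has_real_derivative y) (at s) \<and> 0 \<le> y"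
        by blast
    qed
    then show ?thesis by simp
  qed
  show ?thesis
  proof (cases "\<delta> \<ge> 0")
    case True
    then show ?thesis using *[OF assms True] by (simp add: c_def)
  next
    case False
    have eq: "cosh (- \<eta> - \<delta>) = cosh (\<eta> + \<delta>)"
      by (metis cosh_minus minus_add_distrib uminus_add_conv_diff diff_conv_add_uminus)
    show ?thesis using *[of "- \<eta>" "- \<delta>"] False assms by (simp add: eq c_def del: cosh_real_eq_iff)
  qed
qed

lemma ln_Suc_le_double_ln:
  assumes "d \<ge> (2::nat)"
  shows "ln (real d + 1) \<le> 2 * ln (real d)"
proof -
  have "real d + 1 \<le> real d * 2" using assms by simp
  also have "\<dots> \<le> real d * real d" using assms by (intro mult_left_mono) auto
  finally have "ln (real d + 1) \<le> ln (real d * real d)" using assms by simp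
  then show ?thesis using assms by (simp add: ln_mult)
qed

text \<open>Cauchy-Schwarz against the indicator of the support of \<theta>.\<close>

lemma sparse_l1_le_l2:
  fixes d s :: nat and \<theta> v :: "nat \<Rightarrow> real"
  assumes "card {k. k < d \<and> \<theta> k \<noteq> 0} \<le> s"
  shows "(\<Sum>k<d. if \<theta> k \<noteq> 0 then \<bar>v k\<bar> else 0) \<le> sqrt (real s) * L2_set v {..<d}"
proof -
  have "(\<Sum>k<d. if \<theta> k \<noteq> 0 then \<bar>v k\<bar> else 0) = (\<Sum>k<d. \<bar>if \<theta> k \<noteq> 0 then 1 else 0\<bar> * \<bar>v k\<bar>)"
    by (intro sum.cong) auto
  also have "\<dots> \<le> L2_set (\<lambda>k. if \<theta> k \<noteq> 0 then 1 else 0) {..<d} * L2_set v {..<d}"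
    by (rule L2_set_mult_ineq)
  also have "L2_set (\<lambda>k. if \<theta> k \<noteq> 0 then 1 else 0) {..<d} \<le> sqrt (real s)"
  proof -
    have "(\<Sum>k<d. (if \<theta> k \<noteq> 0 then 1 else 0 :: real)\<^sup>2) = (\<Sum>k<d. if \<theta> k \<noteq> 0 then 1 else 0)"
      by (intro sum.cong) auto
    also have "\<dots> = real (card {k. k < d \<and> \<theta> k \<noteq> 0})"
      by (subst sum.inter_filter[symmetric]) auto
    finally show ?thesis
      unfolding L2_set_def using assms by simp
  qed
  finally show ?thesis by (simp add: mult_right_mono)
qed

section \<open>The smallest eigenvalue of the Gram matrix\<close>

text \<open>The first-order condition at a minimum, used below for perturbations of a minimiser of
  the Rayleigh quotient.\<close>

lemma quadratic_nonneg_imp_linear_zero: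
  fixes a b :: real
  assumes "\<And>s. 0 \<le> 2 * s * a + s\<^sup>2 * b"
  shows "a = 0"
proof (rule ccontr)
  assume "a \<noteq> 0"
  \<comment> \<open>The vertex of the parabola after \<open>b\<close> is replaced by the larger and
    strictly positive \<open>\<bar>b\<bar> + 1\<close>, so that \<open>b\<close> of either sign is
    covered.\<close>
  define s where "s = - a / (\<bar>b\<bar> + 1)"
  have "2 * s * a + s\<^sup>2 * b \<le> 2 * s * a + s\<^sup>2 * (\<bar>b\<bar> + 1)"
    by (intro add_left_mono mult_left_mono) auto
  also have "\<dots> = - a\<^sup>2 / (\<bar>b\<bar> + 1)"
  proof -
    have "\<bar>b\<bar> + 1 \<noteq> 0" by linarith
    then have "s * (\<bar>b\<bar> + 1) = - a" by (simp add: s_def)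
    then have "s\<^sup>2 * (\<bar>b\<bar> + 1) = - a * s" by (simp add: power2_eq_square mult.assoc mult.commute)
    then show ?thesis by (simp add: s_def power2_eq_square)
  qed
  also have "\<dots> < 0"
    using \<open>a \<noteq> 0\<close> by (simp add: divide_neg_pos)
  finally show False using assms[of s] by linarith
qed

text \<open>Rayleigh's principle: a minimiser of the form on the unit sphere is an eigenvector, and
  by homogeneity its value \<mu> bounds the form from below everywhere.\<close>

lemma symmetric_form_min_eigenvector:
  fixes G :: "nat \<Rightarrow> nat \<Rightarrow> real"
  assumes d: "d > 0" and sym: "\<And>k l. k < d \<Longrightarrow> l < d \<Longrightarrow> G k l = G l k"
  obtains \<mu> t where "\<exists>k<d. t k \<noteq> 0" "\<And>k. k < d \<Longrightarrow> (\<Sum>l<d. G k l * t l) = \<mu> * t k"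
    "\<And>v. \<mu> * (\<Sum>k<d. (v k)\<^sup>2) \<le> (\<Sum>k<d. \<Sum>l<d. v k * G k l * v l)"
proof -
  define q where "q = (\<lambda>v :: nat \<Rightarrow> real. \<Sum>k<d. \<Sum>l<d. v k * G k l * v l)"
  define n where "n = (\<lambda>v :: nat \<Rightarrow> real. \<Sum>k<d. (v k)\<^sup>2)"
  \<comment> \<open>Vectors are functions on all naturals, so the coordinates from \<open>d\<close>
    on are pinned to 0. The resulting cube is compact in the product topology by Tychonoff's theorem
    and contains the unit sphere of such vectors.\<close>
  define B where "B = PiE UNIV (\<lambda>k. if k < d then {-1..1::real} else {0})"
  have "compactin (product_topology (\<lambda>_. euclidean) UNIV) B"
    unfolding B_def by (subst compactin_PiE) (auto simp: compactin_euclidean_iff)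
  then have "compact B"
    by (simp add: compactin_euclidean_iff euclidean_product_topology)
  have cont: "continuous_on UNIV (\<lambda>v :: nat \<Rightarrow> real. v k)" for k
    by (rule continuous_on_product_coordinates)
  have contn: "continuous_on UNIV n" and contq: "continuous_on UNIV q"
    unfolding n_def q_def by (intro continuous_intros cont)+
  have "closed (n -` {1})"
    using contn continuous_on_closed_vimage[OF closed_UNIV, of n] by auto
  define S where "S = B \<inter> n -` {1}"
  have "compact S"
    unfolding S_def using \<open>compact B\<close> \<open>closed (n -` {1})\<close> by (rule compact_Int_closed)
  moreover have "(\<lambda>k. if k = 0 then 1 else 0) \<in> S"
  proof -
    have "n (\<lambda>k. if k = 0 then 1 else 0) = (\<Sum>k<d. if k = 0 then 1 else 0)"
      unfolding n_def by (intro sum.cong) auto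
    then show ?thesis using d by (auto simp: S_def B_def)
  qed
  then have "S \<noteq> {}" by blast
  ultimately obtain t where t: "t \<in> S" and tmin: "\<And>v. v \<in> S \<Longrightarrow> q t \<le> q v"
    using continuous_attains_inf[of S q] continuous_on_subset[OF contq] by blast
  define \<mu> where "\<mu> = q t"
  have n_t: "n t = 1" using t by (simp add: S_def)
  have lower: "\<mu> * n v \<le> q v" for v
  proof (cases "n v = 0")
    case True
    then have "\<forall>k<d. v k = 0"
      unfolding n_def by (subst (asm) sum_nonneg_eq_0_iff) auto
    then show ?thesis by (simp add: q_def n_def)
  next
    case False
    moreover have "n v \<ge> 0" unfolding n_def by (intro sum_nonneg) auto
    ultimately have pos: "n v > 0" by linarith
    define r where "r = sqrt (n v)"
    have r: "r > 0" "r\<^sup>2 = n v" using pos by (simp_all add: r_def)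
    define u where "u = (\<lambda>k. if k < d then v k / r else 0)"
    have "n u = n v / r\<^sup>2"
      by (simp add: n_def u_def power_divide sum_divide_distrib)
    then have nu: "n u = 1" using r pos by simp
    have qu: "q u = q v / r\<^sup>2"
      by (simp add: q_def u_def power2_eq_square sum_divide_distrib)
    have "u k \<in> {-1..1}" if "k < d" for k
    proof -
      have "(u k)\<^sup>2 \<le> n u"
        unfolding n_def by (rule member_le_sum) (use that in auto)
      then have "\<bar>u k\<bar> \<le> 1" using nu by (simp add: abs_square_le_1)
      then show ?thesis by auto
    qed
    then have "u \<in> S" using nu by (auto simp: S_def B_def u_def)
    then have "\<mu> \<le> q v / n v" using tmin[of u] by (simp add: qu \<mu>_def r)
    then show ?thesis using pos by (simp add: pos_le_divide_eq)
  qed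
  have "(\<Sum>l<d. G k l * t l) = \<mu> * t k" if k: "k < d" for k
  proof -
    have "(\<Sum>l<d. G k l * t l) - \<mu> * t k = 0"
    proof (rule quadratic_nonneg_imp_linear_zero)
      fix s :: real
      \<comment> \<open>The function \<open>q v - \<mu> * n v\<close> is nonnegative and vanishes at
        \<open>t\<close>. Moving only coordinate \<open>k\<close> by \<open>s\<close> makes it a
        quadratic in \<open>s\<close> whose linear coefficient is twice the \<open>k\<close>-th
        component of \<open>G t - \<mu> t\<close>.\<close>
      define e where "e = (\<lambda>l. if l = k then s else 0 :: real)"
      have n1: "n (\<lambda>l. t l + e l) = n t + 2 * s * t k + s\<^sup>2"
      proof -
        have "n (\<lambda>l. t l + e l) = (\<Sum>l<d. (t l)\<^sup>2 + (if l = k then 2 * s * t k + s\<^sup>2 else 0))"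
          unfolding n_def by (intro sum.cong) (auto simp: e_def power2_eq_square algebra_simps)
        then show ?thesis using k by (simp add: sum.distrib n_def)
      qed
      have row: "(\<Sum>l<d. G j l * (t l + e l)) = (\<Sum>l<d. G j l * t l) + s * G j k" for j
      proof -
        have "(\<Sum>l<d. G j l * (t l + e l)) = (\<Sum>l<d. G j l * t l + (if l = k then s * G j k else 0))"
          by (intro sum.cong) (auto simp: e_def algebra_simps)
        then show ?thesis using k by (simp add: sum.distrib)
      qed
      have q_alt: "q v = (\<Sum>j<d. v j * (\<Sum>l<d. G j l * v l))" for v
        by (simp add: q_def sum_distrib_left mult.assoc)
      have "q (\<lambda>l. t l + e l)
          = (\<Sum>j<d. (t j * (\<Sum>l<d. G j l * t l) + s * (t j * G j k))
             + (if j = k then s * ((\<Sum>l<d. G k l * t l) + s * G k k) else 0))"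
        unfolding q_alt row by (intro sum.cong) (auto simp: e_def algebra_simps)
      also have "\<dots> = q t + s * (\<Sum>j<d. t j * G j k) + s * ((\<Sum>l<d. G k l * t l) + s * G k k)"
        using k by (simp add: sum.distrib q_alt sum_distrib_left)
      also have "(\<Sum>j<d. t j * G j k) = (\<Sum>l<d. G k l * t l)"
        using sym k by (intro sum.cong) auto
      finally have q1: "q (\<lambda>l. t l + e l) = q t + 2 * s * (\<Sum>l<d. G k l * t l) + s\<^sup>2 * G k k"
        by (simp add: algebra_simps power2_eq_square)
      show "0 \<le> 2 * s * ((\<Sum>l<d. G k l * t l) - \<mu> * t k) + s\<^sup>2 * (G k k - \<mu>)"
        using lower[of "\<lambda>l. t l + e l"] unfolding n1 q1 n_t
        by (simp add: \<mu>_def algebra_simps)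
    qed
    then show ?thesis by simp
  qed
  moreover have "\<exists>k<d. t k \<noteq> 0"
  proof (rule ccontr)
    assume "\<not> (\<exists>k<d. t k \<noteq> 0)"
    then have "n t = 0" by (simp add: n_def)
    then show False using n_t by simp
  qed
  ultimately show ?thesis
    using lower that[of t \<mu>] unfolding q_def n_def by blast
qed

text \<open>Turns the spectral hypothesis into coercivity of the design. The minimal Rayleigh
  quotient of the Gram matrix is itself an eigenvalue, so \<open>c\<close> lies below it; the factor
  \<open>real N\<close> undoes the normalisation in \<open>gram\<close>.\<close>

lemma gram_form_ge:
  assumes ev: "\<And>ev. eigenvalue (gram N d Z) ev \<Longrightarrow> c \<le> ev" and N: "N > 0"
  shows "c * real N * (\<Sum>k<d. (v k)\<^sup>2) \<le> (\<Sum>i<N. (\<Sum>k<d. v k * Z i k)\<^sup>2)"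
proof (cases "d = 0")
  case True
  then show ?thesis by simp
next
  case False
  define G where "G = (\<lambda>k l. (\<Sum>i<N. Z i k * Z i l) / real N)"
  have sym: "G k l = G l k" if "k < d" "l < d" for k l
    by (simp add: G_def mult.commute)
  obtain \<mu> t where t: "\<exists>k<d. t k \<noteq> 0" "\<And>k. k < d \<Longrightarrow> (\<Sum>l<d. G k l * t l) = \<mu> * t k"
    and lower: "\<And>v. \<mu> * (\<Sum>k<d. (v k)\<^sup>2) \<le> (\<Sum>k<d. \<Sum>l<d. v k * G k l * v l)"
    by (rule symmetric_form_min_eigenvector[of d G]) (use False sym in auto)
  have "eigenvector (gram N d Z) (Matrix.vec d t) \<mu>"
    unfolding eigenvector_def
  proof (intro conjI)
    show "Matrix.vec d t \<in> carrier_vec (dim_row (gram N d Z))"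
      by (simp add: gram_def)
    show "Matrix.vec d t \<noteq> 0\<^sub>v (dim_row (gram N d Z))"
    proof
      assume "Matrix.vec d t = 0\<^sub>v (dim_row (gram N d Z))"
      then have "Matrix.vec d t $ k = 0\<^sub>v d $ k" for k
        by (simp add: gram_def)
      then have "\<forall>k<d. t k = 0" by (metis index_vec index_zero_vec(1))
      then show False using t(1) by blast
    qed
    show "gram N d Z *\<^sub>v Matrix.vec d t = \<mu> \<cdot>\<^sub>v Matrix.vec d t"
      by (rule eq_vecI)
         (auto simp: gram_def scalar_prod_def t(2)[symmetric] G_def lessThan_atLeast0 intro!: sum.cong)
  qed
  then have "c \<le> \<mu>" using ev by (auto simp: eigenvalue_def)
  then have "c * (\<Sum>k<d. (v k)\<^sup>2) \<le> \<mu> * (\<Sum>k<d. (v k)\<^sup>2)"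
    by (intro mult_right_mono sum_nonneg) auto
  also have "\<dots> \<le> (\<Sum>k<d. \<Sum>l<d. v k * G k l * v l)" by (rule lower)
  also have "\<dots> = (\<Sum>k<d. \<Sum>l<d. \<Sum>i<N. (v k * Z i k) * (v l * Z i l)) / real N"
    by (simp add: G_def sum_divide_distrib sum_distrib_left sum_distrib_right mult_ac)
  also have "(\<Sum>k<d. \<Sum>l<d. \<Sum>i<N. (v k * Z i k) * (v l * Z i l))
      = (\<Sum>k<d. \<Sum>i<N. \<Sum>l<d. (v k * Z i k) * (v l * Z i l))"
    by (intro sum.cong refl sum.swap)
  also have "\<dots> = (\<Sum>i<N. \<Sum>k<d. \<Sum>l<d. (v k * Z i k) * (v l * Z i l))"
    by (rule sum.swap)
  also have "\<dots> = (\<Sum>i<N. (\<Sum>k<d. v k * Z i k)\<^sup>2)"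
    by (simp add: power2_eq_square sum_product)
  finally show ?thesis using N by (simp add: field_simps)
qed

section \<open>Concentration in the Ising model\<close>

definition flip :: "nat \<Rightarrow> (nat \<Rightarrow> real) \<Rightarrow> nat \<Rightarrow> real" where
  "flip i x = x(i := - x i)"

lemma flip_flip [simp]: "flip i (flip i x) = x"
  by (auto simp: flip_def)

lemma flip_eq: "flip i x j = x j + (if j = i then - 2 * x i else 0)"
  by (simp add: flip_def)

lemma flip_spins: "i < N \<Longrightarrow> x \<in> spins N \<Longrightarrow> flip i x \<in> spins N"
  by (auto simp: flip_def spins_def)

lemma finite_spins: "finite (spins N)"
proof -
  have "spins N \<subseteq> (\<lambda>f i. if i < N then f i else 0) ` (PiE {..<N} (\<lambda>_. {1, -1}))"
  proof
    fix x assume x: "x \<in> spins N"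
    have "x = (\<lambda>i. if i < N then restrict x {..<N} i else 0)"
      using x by (auto simp: spins_def)
    moreover have "restrict x {..<N} \<in> PiE {..<N} (\<lambda>_. {1, -1})"
      using x by (auto simp: spins_def)
    ultimately show "x \<in> (\<lambda>f i. if i < N then f i else 0) ` (PiE {..<N} (\<lambda>_. {1, -1}))"
      by blast
  qed
  moreover have "finite (PiE {..<N} (\<lambda>_. {1::real, -1}))"
    by (intro finite_PiE) auto
  ultimately show ?thesis
    using finite_surj by blast
qed

lemma spins_nonempty: "spins N \<noteq> {}"
proof -
  have "(\<lambda>i. if i < N then 1 else 0) \<in> spins N"
    by (auto simp: spins_def)
  then show ?thesis by blast
qed

lemma spins_abs: "x \<in> spins N \<Longrightarrow> i < N \<Longrightarrow> \<bar>x i\<bar> = 1"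
  by (auto simp: spins_def)

lemma sum_spins_flip:
  assumes "i < N"
  shows "(\<Sum>x\<in>spins N. g (flip i x)) = (\<Sum>x\<in>spins N. g x)"
  by (rule sum.reindex_bij_witness[where i = "flip i" and j = "flip i"])
     (auto simp: flip_spins assms)

section \<open>Spin flips and exchangeable pairs at a fixed sample size\<close>

locale ising =
  fixes N d :: nat and A Z :: "nat \<Rightarrow> nat \<Rightarrow> real" and \<beta> :: real and \<theta> :: "nat \<Rightarrow> real"
  assumes A_sym: "i < N \<Longrightarrow> j < N \<Longrightarrow> A i j = A j i"
    and A_diag: "i < N \<Longrightarrow> A i i = 0"
    and A_row: "i < N \<Longrightarrow> (\<Sum>j<N. \<bar>A i j\<bar>) \<le> 1"
    and beta_le: "\<bar>\<beta>\<bar> \<le> 1"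
begin

abbreviation weight :: "(nat \<Rightarrow> real) \<Rightarrow> real" where
  "weight \<equiv> ising_weight N d A Z \<beta> \<theta>"

abbreviation prob :: "(nat \<Rightarrow> real) set \<Rightarrow> real" where
  "prob \<equiv> ising_prob N d A Z \<beta> \<theta>"

text \<open>Given the other spins, \<open>x i\<close> has conditional mean
  \<open>tanh (field x i)\<close>; \<open>resid\<close> is the deviation from this mean.\<close>

definition field :: "(nat \<Rightarrow> real) \<Rightarrow> nat \<Rightarrow> real" where
  "field x i = \<beta> * local_field N A x i + (\<Sum>k<d. \<theta> k * Z i k)"

definition resid :: "(nat \<Rightarrow> real) \<Rightarrow> nat \<Rightarrow> real" where
  "resid x i = x i - tanh (field x i)"

lemma weight_pos: "weight x > 0"
  by (simp add: ising_weight_def)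

lemma A_col: "i < N \<Longrightarrow> (\<Sum>j<N. \<bar>A j i\<bar>) \<le> 1"
  using A_row[of i] A_sym by (metis (no_types, lifting) lessThan_iff sum.cong)

lemma local_field_flip:
  assumes "i < N"
  shows "local_field N A (flip i x) j = local_field N A x j - 2 * x i * A j i"
proof -
  have "(\<Sum>l<N. A j l * (if l = i then - 2 * x i else 0)) = (\<Sum>l<N. if l = i then A j i * (- 2 * x i) else 0)"
    by (intro sum.cong) auto
  also have "\<dots> = - 2 * x i * A j i"
    using assms by simp
  finally show ?thesis
    by (simp add: local_field_def flip_eq algebra_simps sum.distrib)
qed

lemma field_flip:
  "i < N \<Longrightarrow> field (flip i x) j = field x j - 2 * \<beta> * x i * A j i"
  by (simp add: field_def local_field_flip algebra_simps)

text \<open>Row \<open>i\<close> and column \<open>i\<close> of the form each change by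
  \<open>- 2 * x i * local_field N A x i\<close>, the two being equal by symmetry. The entry that is
  flipped twice lies on the diagonal and vanishes.\<close>

lemma quadratic_flip:
  assumes "i < N"
  shows "(\<Sum>j<N. \<Sum>l<N. flip i x j * A j l * flip i x l)
       = (\<Sum>j<N. \<Sum>l<N. x j * A j l * x l) - 4 * x i * local_field N A x i"
proof -
  have q: "(\<Sum>j<N. \<Sum>l<N. y j * A j l * y l) = (\<Sum>j<N. y j * local_field N A y j)" for y
    by (simp add: local_field_def sum_distrib_left mult.assoc)
  have sym: "(\<Sum>j<N. x j * A j i) = local_field N A x i"
    unfolding local_field_def using assms A_sym by (intro sum.cong) auto
  have "(\<Sum>j<N. flip i x j * local_field N A (flip i x) j)
      = (\<Sum>j<N. x j * local_field N A x j - 2 * x i * (x j * A j i)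
           + (if j = i then - 2 * x i * (local_field N A x i - 2 * x i * A i i) else 0))"
    using assms by (intro sum.cong) (auto simp: local_field_flip flip_eq algebra_simps)
  also have "\<dots> = (\<Sum>j<N. x j * local_field N A x j) - 2 * x i * (\<Sum>j<N. x j * A j i)
        - 2 * x i * (local_field N A x i - 2 * x i * A i i)"
    using assms by (simp add: sum.distrib sum_subtractf sum_distrib_left)
  finally show ?thesis
    unfolding q using assms by (simp add: sym A_diag)
qed

text \<open>The prefactor \<open>\<beta> / 2\<close> halves the change in
  \<open>quadratic_flip\<close>, so the quadratic and the linear part of the exponent combine to a
  multiple of \<open>field x i\<close>.\<close>

lemma weight_flip:
  assumes "i < N"
  shows "weight (flip i x) = weight x * exp (- 2 * x i * field x i)"
proof -
  have lin: "(\<Sum>j<N. flip i x j * Z j k) = (\<Sum>j<N. x j * Z j k) - 2 * x i * Z i k" for k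
  proof -
    have "(\<Sum>j<N. flip i x j * Z j k) = (\<Sum>j<N. x j * Z j k + (if j = i then - 2 * x i * Z i k else 0))"
      by (intro sum.cong) (auto simp: flip_eq algebra_simps)
    then show ?thesis using assms by (simp add: sum.distrib)
  qed
  have "(\<Sum>k<d. \<theta> k * (\<Sum>j<N. flip i x j * Z j k))
      = (\<Sum>k<d. \<theta> k * (\<Sum>j<N. x j * Z j k)) - 2 * x i * (\<Sum>k<d. \<theta> k * Z i k)"
    unfolding lin by (simp add: algebra_simps sum_subtractf sum_distrib_left)
  then show ?thesis
    unfolding ising_weight_def quadratic_flip[OF assms] field_def
    by (simp add: algebra_simps flip: exp_add)
qed

text \<open>This antisymmetry says that the residual is conditionally centred given the other spins.\<close>

lemma weight_resid_flip:
  assumes "i < N" "x \<in> spins N"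
  shows "weight (flip i x) * resid (flip i x) i = - (weight x * resid x i)"
proof -
  define e where "e = field x i"
  \<comment> \<open>The zero diagonal makes the field at \<open>i\<close> independent of
    \<open>x i\<close>, so both residuals contain the same tanh. What remains is
    \<open>exp (- 2 * e) * (1 + tanh e) = 1 - tanh e\<close> or its mirror image.\<close>
  have "e = field (flip i x) i"
    using assms by (simp add: e_def field_flip A_diag)
  then have r: "resid (flip i x) i = - x i - tanh e"
    by (simp add: resid_def flip_def)
  have pos: "1 + exp (- 2 * e) > 0"
    by (simp add: add_pos_pos)
  have "exp (- 2 * x i * e) * (- x i - tanh e) = - (x i - tanh e)"
  proof -
    consider "x i = 1" | "x i = -1" using assms by (auto simp: spins_def)
    then show ?thesis
      using pos unfolding tanh_real_altdef
      by cases (simp_all add: divide_simps, simp_all add: algebra_simps flip: exp_add)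
  qed
  then show ?thesis
    unfolding weight_flip[OF assms(1)] r resid_def[of x] e_def[symmetric] mult.assoc
    by (simp only: mult_minus_right)
qed

lemma resid_abs_le: "i < N \<Longrightarrow> x \<in> spins N \<Longrightarrow> \<bar>resid x i\<bar> \<le> 2"
  using tanh_real_bounds[of "field x i"] by (auto simp: resid_def spins_def abs_le_iff)

text \<open>Reindexing by the flip gives minus the same sum with \<open>g\<close> evaluated at the
  flipped configuration; averaging the two expressions produces the difference. Here
  \<open>c\<close> stands for a coefficient that does not depend on \<open>x i\<close>.\<close>

lemma sum_resid_antisym:
  assumes i: "i < N"
    and inv: "\<And>x. x \<in> spins N \<Longrightarrow> c (flip i x) = c x"
  shows "(\<Sum>x\<in>spins N. weight x * resid x i * c x * g x)
       = (\<Sum>x\<in>spins N. weight x * resid x i * c x * (g x - g (flip i x))) / 2"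
proof -
  have "(\<Sum>x\<in>spins N. weight x * resid x i * c x * g x)
      = (\<Sum>x\<in>spins N. weight (flip i x) * resid (flip i x) i * c (flip i x) * g (flip i x))"
    by (rule sum_spins_flip[OF i, symmetric])
  also have "\<dots> = (\<Sum>x\<in>spins N. - (weight x * resid x i * c x * g (flip i x)))"
    by (intro sum.cong) (simp_all add: weight_resid_flip[OF i] inv)
  finally show ?thesis
    by (simp add: right_diff_distrib sum_subtractf sum_negf)
qed

text \<open>Under absolute values the antisymmetric factor becomes flip invariant.\<close>

lemma sum_abs_resid_flip:
  assumes i: "i < N"
    and inv: "\<And>x. x \<in> spins N \<Longrightarrow> c (flip i x) = c x"
  shows "(\<Sum>x\<in>spins N. weight x * \<bar>resid x i\<bar> * \<bar>c x\<bar> * g (flip i x))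
       = (\<Sum>x\<in>spins N. weight x * \<bar>resid x i\<bar> * \<bar>c x\<bar> * g x)"
proof -
  have w: "weight (flip i x) * \<bar>resid (flip i x) i\<bar> = weight x * \<bar>resid x i\<bar>"
    if "x \<in> spins N" for x
    using arg_cong[OF weight_resid_flip[OF i that], of abs]
    by (simp add: abs_mult less_imp_le[OF weight_pos])
  have "(\<Sum>x\<in>spins N. weight x * \<bar>resid x i\<bar> * \<bar>c x\<bar> * g (flip i x))
      = (\<Sum>x\<in>spins N. weight (flip i x) * \<bar>resid (flip i x) i\<bar> * \<bar>c (flip i x)\<bar> * g (flip i x))"
    by (intro sum.cong) (simp_all add: w inv)
  also have "\<dots> = (\<Sum>x\<in>spins N. weight x * \<bar>resid x i\<bar> * \<bar>c x\<bar> * g x)"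
    by (rule sum_spins_flip[OF i, of "\<lambda>x. weight x * \<bar>resid x i\<bar> * \<bar>c x\<bar> * g x"])
  finally show ?thesis .
qed

text \<open>The contribution of one site to the derivative of the moment generating function.
  Antisymmetrising produces a difference of exponentials, the Lipschitz bound extracts the factor
  \<open>t * D\<close> from it, and flip invariance merges the two exponentials into one. The factor
  2 is the bound on the residual.\<close>

lemma tilted_sum_le:
  assumes i: "i < N"
    and inv: "\<And>x. x \<in> spins N \<Longrightarrow> c (flip i x) = c x"
    and bound: "\<And>x. x \<in> spins N \<Longrightarrow> \<bar>c x\<bar> \<le> Q"
    and lip: "\<And>x. x \<in> spins N \<Longrightarrow> \<bar>f x - f (flip i x)\<bar> \<le> D"
    and t: "t \<ge> 0"
  shows "(\<Sum>x\<in>spins N. weight x * resid x i * c x * exp (t * f x))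
     \<le> 2 * t * D * Q * (\<Sum>x\<in>spins N. weight x * exp (t * f x))"
proof -
  obtain x0 where x0: "x0 \<in> spins N" using spins_nonempty by blast
  have D: "D \<ge> 0" using lip[OF x0] by linarith
  let ?W = "\<lambda>x. weight x * \<bar>resid x i\<bar> * \<bar>c x\<bar>"
  have W: "0 \<le> ?W x" for x
    by (simp add: less_imp_le[OF weight_pos])
  have "(\<Sum>x\<in>spins N. weight x * resid x i * c x * exp (t * f x))
      = (\<Sum>x\<in>spins N. weight x * resid x i * c x * (exp (t * f x) - exp (t * f (flip i x)))) / 2"
    using sum_resid_antisym[OF i, of c "\<lambda>x. exp (t * f x)"] inv by simp
  also have "\<dots> \<le> (\<Sum>x\<in>spins N. ?W x * (t * D * (exp (t * f x) + exp (t * f (flip i x))))) / 2"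
  proof (intro divide_right_mono sum_mono)
    fix x assume x: "x \<in> spins N"
    have "\<bar>exp (t * f x) - exp (t * f (flip i x))\<bar>
        \<le> \<bar>t * f x - t * f (flip i x)\<bar> * (exp (t * f x) + exp (t * f (flip i x)))"
      by (rule exp_abs_diff_le)
    also have "\<bar>t * f x - t * f (flip i x)\<bar> = t * \<bar>f x - f (flip i x)\<bar>"
      using t by (simp add: abs_mult flip: right_diff_distrib)
    also have "t * \<bar>f x - f (flip i x)\<bar> * (exp (t * f x) + exp (t * f (flip i x)))
        \<le> t * D * (exp (t * f x) + exp (t * f (flip i x)))"
      using lip[OF x] t by (intro mult_right_mono mult_left_mono) (auto intro: add_nonneg_nonneg)
    finally have *: "\<bar>exp (t * f x) - exp (t * f (flip i x))\<bar>
        \<le> t * D * (exp (t * f x) + exp (t * f (flip i x)))" .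
    have "weight x * resid x i * c x * (exp (t * f x) - exp (t * f (flip i x)))
        \<le> \<bar>weight x * resid x i * c x * (exp (t * f x) - exp (t * f (flip i x)))\<bar>"
      by (rule abs_ge_self)
    also have "\<dots> = ?W x * \<bar>exp (t * f x) - exp (t * f (flip i x))\<bar>"
      by (simp add: abs_mult less_imp_le[OF weight_pos])
    also have "\<dots> \<le> ?W x * (t * D * (exp (t * f x) + exp (t * f (flip i x))))"
      by (rule mult_left_mono[OF * W])
    finally show "weight x * resid x i * c x * (exp (t * f x) - exp (t * f (flip i x)))
        \<le> ?W x * (t * D * (exp (t * f x) + exp (t * f (flip i x))))" .
  qed simp
  also have "\<dots> = t * D * ((\<Sum>x\<in>spins N. ?W x * exp (t * f x))
      + (\<Sum>x\<in>spins N. ?W x * exp (t * f (flip i x)))) / 2"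
    by (simp add: sum_distrib_left sum.distrib algebra_simps)
  also have "\<dots> = t * D * (\<Sum>x\<in>spins N. ?W x * exp (t * f x))"
    using sum_abs_resid_flip[OF i, of c "\<lambda>x. exp (t * f x)"] inv by simp
  also have "\<dots> \<le> t * D * (\<Sum>x\<in>spins N. 2 * Q * (weight x * exp (t * f x)))"
  proof (intro mult_left_mono sum_mono)
    fix x assume x: "x \<in> spins N"
    have "\<bar>resid x i\<bar> * \<bar>c x\<bar> \<le> 2 * Q"
      using resid_abs_le[OF i x] bound[OF x] by (intro mult_mono) auto
    then have "\<bar>resid x i\<bar> * \<bar>c x\<bar> * (weight x * exp (t * f x)) \<le> 2 * Q * (weight x * exp (t * f x))"
      by (intro mult_right_mono) (simp_all add: less_imp_le[OF weight_pos])
    then show "?W x * exp (t * f x) \<le> 2 * Q * (weight x * exp (t * f x))"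
      by (simp add: mult_ac)
  qed (use t D in simp)
  also have "\<dots> = 2 * t * D * Q * (\<Sum>x\<in>spins N. weight x * exp (t * f x))"
    by (simp add: sum_distrib_left mult_ac)
  finally show ?thesis .
qed

text \<open>Chatterjee's exchangeable pair method: by the antisymmetry of the residuals, the moment
  generating function \<open>m\<close> satisfies \<open>m' \<le> 2 K t m\<close> with \<open>K = D Q N\<close>.\<close>

lemma mgf_le:
  fixes c :: "nat \<Rightarrow> (nat \<Rightarrow> real) \<Rightarrow> real"
  defines "f \<equiv> \<lambda>x. \<Sum>i<N. c i x * resid x i"
  assumes inv: "\<And>i x. i < N \<Longrightarrow> x \<in> spins N \<Longrightarrow> c i (flip i x) = c i x"
    and bound: "\<And>i x. i < N \<Longrightarrow> x \<in> spins N \<Longrightarrow> \<bar>c i x\<bar> \<le> Q"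
    and lip: "\<And>i x. i < N \<Longrightarrow> x \<in> spins N \<Longrightarrow> \<bar>f x - f (flip i x)\<bar> \<le> D"
    and t: "t \<ge> 0"
  shows "(\<Sum>x\<in>spins N. weight x * exp (t * f x))
     \<le> (\<Sum>x\<in>spins N. weight x) * exp (D * Q * real N * t\<^sup>2)"
proof -
  define m where "m = (\<lambda>t. \<Sum>x\<in>spins N. weight x * exp (t * f x))"
  define m' where "m' = (\<lambda>t. \<Sum>x\<in>spins N. weight x * f x * exp (t * f x))"
  define K where "K = D * Q * real N"
  have der: "(m has_real_derivative m' t) (at t)" for t
    unfolding m_def m'_def
    by (auto intro!: derivative_eq_intros sum.cong)
  have le: "m' s \<le> 2 * K * s * m s" if s: "s \<ge> 0" for s
  proof -
    have "m' s = (\<Sum>i<N. \<Sum>x\<in>spins N. weight x * resid x i * c i x * exp (s * f x))"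
      unfolding m'_def
      by (subst sum.swap) (simp add: f_def sum_distrib_left sum_distrib_right mult_ac)
    also have "\<dots> \<le> (\<Sum>i<N. 2 * s * D * Q * m s)"
      unfolding m_def
      by (intro sum_mono tilted_sum_le) (use inv bound lip s in auto)
    finally show ?thesis by (simp add: K_def mult_ac)
  qed
  \<comment> \<open>Gronwall's argument: the integrating factor \<open>exp (- K * t\<^sup>2)\<close>
    turns the differential inequality into monotonicity.\<close>
  have "m t * exp (- K * t\<^sup>2) \<le> m 0 * exp (- K * 0\<^sup>2)"
  proof (rule DERIV_nonpos_imp_nonincreasing[OF t])
    fix s :: real assume s: "0 \<le> s" "s \<le> t"
    have "((\<lambda>t. m t * exp (- K * t\<^sup>2)) has_real_derivative
        (m' s - 2 * K * s * m s) * exp (- K * s\<^sup>2)) (at s)"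
      by (auto intro!: derivative_eq_intros der simp: algebra_simps)
    moreover have "(m' s - 2 * K * s * m s) * exp (- K * s\<^sup>2) \<le> 0"
      using le[OF s(1)] by (intro mult_nonpos_nonneg) auto
    ultimately show "\<exists>y. ((\<lambda>t. m t * exp (- K * t\<^sup>2)) has_real_derivative y) (at s) \<and> y \<le> 0"
      by blast
  qed
  then have "m t * exp (- K * t\<^sup>2) * exp (K * t\<^sup>2) \<le> m 0 * exp (K * t\<^sup>2)"
    by (intro mult_right_mono) auto
  then have "m t \<le> m 0 * exp (K * t\<^sup>2)"
    by (simp add: mult.assoc flip: exp_add)
  then show ?thesis
    by (simp add: m_def K_def)
qed

lemma partition_pos: "(\<Sum>x\<in>spins N. weight x) > 0"
  by (intro sum_pos) (auto simp: finite_spins spins_nonempty weight_pos)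

lemma tail_bound:
  fixes c :: "nat \<Rightarrow> (nat \<Rightarrow> real) \<Rightarrow> real"
  defines "f \<equiv> \<lambda>x. \<Sum>i<N. c i x * resid x i"
  assumes inv: "\<And>i x. i < N \<Longrightarrow> x \<in> spins N \<Longrightarrow> c i (flip i x) = c i x"
    and bound: "\<And>i x. i < N \<Longrightarrow> x \<in> spins N \<Longrightarrow> \<bar>c i x\<bar> \<le> Q"
    and lip: "\<And>i x. i < N \<Longrightarrow> x \<in> spins N \<Longrightarrow> \<bar>f x - f (flip i x)\<bar> \<le> D"
    and pos: "a \<ge> 0" "Q > 0" "D > 0" "N > 0"
  shows "prob {x. f x \<ge> a} \<le> exp (- a\<^sup>2 / (4 * D * Q * real N))"
proof -
  define K where "K = D * Q * real N"
  have K: "K > 0" using pos by (simp add: K_def)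
  \<comment> \<open>The minimiser of the Chernoff exponent \<open>K * t\<^sup>2 - t * a\<close>,
    whose minimum is \<open>- a\<^sup>2 / (4 * K)\<close>.\<close>
  define t where "t = a / (2 * K)"
  have t: "t \<ge> 0" using pos K by (simp add: t_def)
  let ?S = "\<Sum>x\<in>spins N. weight x"
  have "(\<Sum>x\<in>spins N \<inter> {x. f x \<ge> a}. weight x) \<le> (\<Sum>x\<in>spins N \<inter> {x. f x \<ge> a}. weight x * exp (t * f x) * exp (- t * a))"
  proof (rule sum_mono)
    fix x assume "x \<in> spins N \<inter> {x. f x \<ge> a}"
    then have "t * a \<le> t * f x" using t by (auto intro: mult_left_mono)
    then have "1 \<le> exp (t * f x) * exp (- t * a)" by (simp flip: exp_add)
    then have "weight x * 1 \<le> weight x * (exp (t * f x) * exp (- t * a))"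
      by (rule mult_left_mono) (simp add: less_imp_le[OF weight_pos])
    then show "weight x \<le> weight x * exp (t * f x) * exp (- t * a)"
      by (simp add: mult.assoc)
  qed
  also have "\<dots> \<le> (\<Sum>x\<in>spins N. weight x * exp (t * f x) * exp (- t * a))"
    by (intro sum_mono2) (auto simp: finite_spins less_imp_le[OF weight_pos])
  also have "\<dots> = (\<Sum>x\<in>spins N. weight x * exp (t * f x)) * exp (- t * a)"
    by (simp add: sum_distrib_right)
  also have "\<dots> \<le> ?S * exp (K * t\<^sup>2) * exp (- t * a)"
    using mgf_le[of c Q D t] inv bound lip t unfolding f_def K_def
    by (intro mult_right_mono) auto
  also have "\<dots> = ?S * exp (K * t\<^sup>2 - t * a)"
    by (simp add: mult.assoc flip: exp_add)
  also have "K * t\<^sup>2 - t * a = - a\<^sup>2 / (4 * D * Q * real N)"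
    using K by (simp add: t_def K_def[symmetric] field_simps power2_eq_square mult.assoc)
       (simp add: K_def field_simps)
  finally show ?thesis
    unfolding ising_prob_def using partition_pos by (simp add: field_simps)
qed

section \<open>Union bounds and complements for the Ising measure\<close>

lemma prob_mono:
  assumes "\<And>x. x \<in> spins N \<Longrightarrow> x \<in> E \<Longrightarrow> x \<in> F"
  shows "prob E \<le> prob F"
  unfolding ising_prob_def using partition_pos assms
  by (intro divide_right_mono sum_mono2) (auto simp: finite_spins less_imp_le[OF weight_pos])

lemma prob_Un_le: "prob (E \<union> F) \<le> prob E + prob F"
proof -
  have "(\<Sum>x\<in>spins N \<inter> (E \<union> F). weight x) \<le> (\<Sum>x\<in>spins N \<inter> E. weight x) + (\<Sum>x\<in>spins N \<inter> F. weight x)"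
  proof -
    have "0 \<le> (\<Sum>x\<in>(spins N \<inter> E) \<inter> (spins N \<inter> F). weight x)"
      by (intro sum_nonneg less_imp_le[OF weight_pos])
    then show ?thesis
      using sum.union_inter[of "spins N \<inter> E" "spins N \<inter> F" weight]
      by (simp add: finite_spins Int_Un_distrib)
  qed
  then show ?thesis
    unfolding ising_prob_def add_divide_distrib[symmetric]
    using partition_pos by (intro divide_right_mono) auto
qed

lemma prob_UN_le:
  assumes "\<And>k. k < n \<Longrightarrow> prob (E k) \<le> p"
  shows "prob (\<Union>k<n. E k) \<le> real n * p"
  using assms
proof (induction n)
  case 0
  then show ?case by (simp add: ising_prob_def)
next
  case (Suc n)
  have "prob (\<Union>k<Suc n. E k) \<le> prob (E n) + prob (\<Union>k<n. E k)"
    by (simp add: lessThan_Suc prob_Un_le)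
  also have "\<dots> \<le> p + real n * p"
    using Suc by (intro add_mono) auto
  finally show ?case by (simp add: algebra_simps)
qed

lemma prob_compl: "prob (- E) = 1 - prob E"
proof -
  have "(\<Sum>x\<in>spins N. weight x) = (\<Sum>x\<in>spins N \<inter> E. weight x) + (\<Sum>x\<in>spins N \<inter> - E. weight x)"
    by (rule sum.Int_Diff[OF finite_spins, of _ _ E, unfolded Diff_eq])
  then show ?thesis
    unfolding ising_prob_def using partition_pos by (simp add: field_simps)
qed

lemma prob_le_1: "prob E \<le> 1"
proof -
  have "prob (- E) \<ge> 0"
    unfolding ising_prob_def by (intro divide_nonneg_nonneg sum_nonneg less_imp_le[OF weight_pos])
  then show ?thesis by (simp add: prob_compl)
qed

section \<open>Residual statistics with affine coefficients\<close>

definition affine_stat :: "(nat \<Rightarrow> real) \<Rightarrow> (nat \<Rightarrow> nat \<Rightarrow> real) \<Rightarrow> (nat \<Rightarrow> real) \<Rightarrow> real" where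
  "affine_stat a B x = (\<Sum>i<N. (a i + local_field N B x i) * resid x i)"

text \<open>The zero diagonal makes the \<open>i\<close>-th coefficient independent of
  \<open>x i\<close>, and the row sums bound it by \<open>M + 1\<close>. The column sums control a
  flip at \<open>i\<close>: coefficients move by \<open>2 * \<bar>B j i\<bar>\<close> against
  residuals of size at most 2, in all 4; residuals move by at most 2 at the flipped site plus
  \<open>2 * \<bar>A j i\<bar>\<close> at each \<open>j\<close>, in all \<open>4 * (M + 1)\<close>
  after weighting. This is the Lipschitz constant \<open>4 * (M + 2)\<close>.\<close>

lemma affine_stat_upper_tail:
  assumes a: "\<And>i. i < N \<Longrightarrow> \<bar>a i\<bar> \<le> M"
    and diag: "\<And>i. i < N \<Longrightarrow> B i i = 0"
    and row: "\<And>i. i < N \<Longrightarrow> (\<Sum>j<N. \<bar>B i j\<bar>) \<le> 1"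
    and col: "\<And>i. i < N \<Longrightarrow> (\<Sum>j<N. \<bar>B j i\<bar>) \<le> 1"
    and pos: "u \<ge> 0" "N > 0" "M > 0"
  shows "prob {x. affine_stat a B x \<ge> u} \<le> exp (- u\<^sup>2 / (16 * (M + 2) * (M + 1) * real N))"
proof -
  define c where "c = (\<lambda>i x. a i + local_field N B x i)"
  have c_flip: "c j (flip i x) = c j x - 2 * x i * B j i" if i: "i < N" for i j x
  proof -
    have "(\<Sum>l<N. B j l * (if l = i then - 2 * x i else 0)) = (\<Sum>l<N. if l = i then B j i * (- 2 * x i) else 0)"
      by (intro sum.cong) auto
    then show ?thesis
      using i by (simp add: c_def local_field_def flip_eq algebra_simps sum.distrib)
  qed
  have c_bound: "\<bar>c i x\<bar> \<le> M + 1" if i: "i < N" and x: "x \<in> spins N" for i x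
  proof -
    have "\<bar>local_field N B x i\<bar> \<le> (\<Sum>j<N. \<bar>B i j * x j\<bar>)"
      unfolding local_field_def by (rule sum_abs)
    also have "\<dots> = (\<Sum>j<N. \<bar>B i j\<bar>)"
      using x by (intro sum.cong) (auto simp: abs_mult spins_abs)
    finally show ?thesis
      using a[OF i] row[OF i] by (simp add: c_def)
  qed
  have lip: "\<bar>(\<Sum>j<N. c j x * resid x j) - (\<Sum>j<N. c j (flip i x) * resid (flip i x) j)\<bar> \<le> 4 * (M + 2)"
    if i: "i < N" and x: "x \<in> spins N" for i x
  proof -
    have y: "flip i x \<in> spins N" using i x by (rule flip_spins)
    have "\<bar>(\<Sum>j<N. c j x * resid x j) - (\<Sum>j<N. c j (flip i x) * resid (flip i x) j)\<bar>
       \<le> (\<Sum>j<N. \<bar>c j x * resid x j - c j (flip i x) * resid (flip i x) j\<bar>)"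
      by (simp add: sum_subtractf[symmetric] sum_abs)
    also have "\<dots> \<le> (\<Sum>j<N. 4 * \<bar>B j i\<bar> + (M + 1) * ((if j = i then 2 else 0) + 2 * \<bar>A j i\<bar>))"
    proof (rule sum_mono)
      fix j assume "j \<in> {..<N}"
      then have j: "j < N" by simp
      have "\<bar>tanh (field (flip i x) j) - tanh (field x j)\<bar> \<le> \<bar>field (flip i x) j - field x j\<bar>"
        by (rule tanh_abs_diff_le)
      also have "\<dots> = \<bar>\<beta>\<bar> * (2 * \<bar>A j i\<bar>)"
        using spins_abs[OF x i] by (simp add: field_flip[OF i] abs_mult)
      also have "\<dots> \<le> 1 * (2 * \<bar>A j i\<bar>)"
        using beta_le by (intro mult_right_mono) auto
      finally have t: "\<bar>tanh (field (flip i x) j) - tanh (field x j)\<bar> \<le> 2 * \<bar>A j i\<bar>" by simp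
      have "\<bar>x j - flip i x j\<bar> = (if j = i then 2 else 0)"
        using spins_abs[OF x i] by (simp add: flip_eq abs_mult)
      then have r: "\<bar>resid x j - resid (flip i x) j\<bar> \<le> (if j = i then 2 else 0) + 2 * \<bar>A j i\<bar>"
        using t unfolding resid_def by linarith
      \<comment> \<open>Discrete product rule, separating the change of the coefficient from the
        change of the residual.\<close>
      have eq: "c j x * resid x j - c j (flip i x) * resid (flip i x) j
          = 2 * x i * B j i * resid x j + c j (flip i x) * (resid x j - resid (flip i x) j)"
        by (simp add: c_flip[OF i] algebra_simps)
      have "\<bar>2 * x i * B j i * resid x j\<bar> = 2 * \<bar>B j i\<bar> * \<bar>resid x j\<bar>"
        using spins_abs[OF x i] by (simp add: abs_mult)
      also have "\<dots> \<le> 2 * \<bar>B j i\<bar> * 2"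
        using resid_abs_le[OF j x] by (intro mult_left_mono) auto
      finally have "\<bar>2 * x i * B j i * resid x j\<bar> \<le> 4 * \<bar>B j i\<bar>" by simp
      moreover have "\<bar>c j (flip i x) * (resid x j - resid (flip i x) j)\<bar>
          \<le> (M + 1) * ((if j = i then 2 else 0) + 2 * \<bar>A j i\<bar>)"
        unfolding abs_mult using c_bound[OF j y] r pos by (intro mult_mono) auto
      ultimately show "\<bar>c j x * resid x j - c j (flip i x) * resid (flip i x) j\<bar>
          \<le> 4 * \<bar>B j i\<bar> + (M + 1) * ((if j = i then 2 else 0) + 2 * \<bar>A j i\<bar>)"
        unfolding eq by (intro order_trans[OF abs_triangle_ineq] add_mono)
    qed
    also have "\<dots> = 4 * (\<Sum>j<N. \<bar>B j i\<bar>) + (M + 1) * (2 + 2 * (\<Sum>j<N. \<bar>A j i\<bar>))"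
      using i by (simp add: sum.distrib flip: sum_distrib_left)
    also have "\<dots> \<le> 4 * 1 + (M + 1) * (2 + 2 * 1)"
      using col[OF i] A_col[OF i] pos by (intro add_mono mult_left_mono) auto
    also have "\<dots> = 4 * (M + 2)" by (simp add: algebra_simps)
    finally show ?thesis .
  qed
  have "prob {x. u \<le> (\<Sum>i<N. c i x * resid x i)} \<le> exp (- u\<^sup>2 / (4 * (4 * (M + 2)) * (M + 1) * real N))"
  proof (rule tail_bound)
    show "c i (flip i x) = c i x" if "i < N" for i x
      using that by (simp add: c_flip diag)
    show "\<bar>(\<Sum>j<N. c j x * resid x j) - (\<Sum>j<N. c j (flip i x) * resid (flip i x) j)\<bar> \<le> 4 * (M + 2)"
      if "i < N" "x \<in> spins N" for i x
      using that by (rule lip)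
  qed (use pos in \<open>auto intro: c_bound\<close>)
  then show ?thesis
    by (simp add: affine_stat_def c_def)
qed

lemma affine_stat_tail:
  assumes a: "\<And>i. i < N \<Longrightarrow> \<bar>a i\<bar> \<le> M"
    and diag: "\<And>i. i < N \<Longrightarrow> B i i = 0"
    and row: "\<And>i. i < N \<Longrightarrow> (\<Sum>j<N. \<bar>B i j\<bar>) \<le> 1"
    and col: "\<And>i. i < N \<Longrightarrow> (\<Sum>j<N. \<bar>B j i\<bar>) \<le> 1"
    and pos: "u \<ge> 0" "N > 0" "M > 0"
  shows "prob {x. \<bar>affine_stat a B x\<bar> \<ge> u} \<le> 2 * exp (- u\<^sup>2 / (16 * (M + 2) * (M + 1) * real N))"
proof -
  have neg: "affine_stat (\<lambda>i. - a i) (\<lambda>i j. - B i j) x = - affine_stat a B x" for x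
  proof -
    have "local_field N (\<lambda>i j. - B i j) x i = - local_field N B x i" for i
      by (simp add: local_field_def sum_negf)
    then show ?thesis
      unfolding affine_stat_def sum_negf[symmetric]
      by (intro sum.cong) (auto simp: algebra_simps)
  qed
  have "{x. \<bar>affine_stat a B x\<bar> \<ge> u}
      = {x. affine_stat a B x \<ge> u} \<union> {x. affine_stat (\<lambda>i. - a i) (\<lambda>i j. - B i j) x \<ge> u}"
    unfolding neg by (auto simp: abs_if)
  moreover have "prob {x. affine_stat a B x \<ge> u} \<le> exp (- u\<^sup>2 / (16 * (M + 2) * (M + 1) * real N))"
    by (rule affine_stat_upper_tail) (use assms in auto)
  moreover have "prob {x. affine_stat (\<lambda>i. - a i) (\<lambda>i j. - B i j) x \<ge> u}
      \<le> exp (- u\<^sup>2 / (16 * (M + 2) * (M + 1) * real N))"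
    by (rule affine_stat_upper_tail) (use assms in auto)
  ultimately show ?thesis
    using prob_Un_le[of "{x. affine_stat a B x \<ge> u}" "{x. affine_stat (\<lambda>i. - a i) (\<lambda>i j. - B i j) x \<ge> u}"]
    by simp
qed

lemma local_field_abs_le:
  assumes "i < N" "\<And>j. j < N \<Longrightarrow> \<bar>y j\<bar> \<le> c" "c \<ge> 0"
  shows "\<bar>local_field N A y i\<bar> \<le> c"
proof -
  have "\<bar>local_field N A y i\<bar> \<le> (\<Sum>j<N. \<bar>A i j * y j\<bar>)"
    unfolding local_field_def by (rule sum_abs)
  also have "\<dots> \<le> (\<Sum>j<N. \<bar>A i j\<bar> * c)"
    unfolding abs_mult using assms by (intro sum_mono mult_left_mono) auto
  also have "\<dots> \<le> 1 * c"
    unfolding sum_distrib_right[symmetric] using A_row[OF assms(1)] assms(3)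
    by (intro mult_right_mono) auto
  finally show ?thesis by simp
qed

text \<open>The diagonal of the squared matrix is removed so that \<open>affine_stat_tail\<close>
  applies; it carries the main term of \<open>shift_pairing_ge\<close> and is treated separately
  there.\<close>

definition A_sq_off :: "nat \<Rightarrow> nat \<Rightarrow> real" where
  "A_sq_off i j = (if i = j then 0 else \<Sum>l<N. A i l * A l j)"

text \<open>The maximal absolute row sum is submultiplicative, and deleting the diagonal can only
  decrease it.\<close>

lemma A_sq_off_row:
  assumes "i < N"
  shows "(\<Sum>j<N. \<bar>A_sq_off i j\<bar>) \<le> 1"
proof -
  have "(\<Sum>j<N. \<bar>A_sq_off i j\<bar>) \<le> (\<Sum>j<N. \<Sum>l<N. \<bar>A i l\<bar> * \<bar>A l j\<bar>)"
  proof (rule sum_mono)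
    fix j
    have "\<bar>\<Sum>l<N. A i l * A l j\<bar> \<le> (\<Sum>l<N. \<bar>A i l * A l j\<bar>)" by (rule sum_abs)
    then show "\<bar>A_sq_off i j\<bar> \<le> (\<Sum>l<N. \<bar>A i l\<bar> * \<bar>A l j\<bar>)"
      by (auto simp: A_sq_off_def abs_mult intro: sum_nonneg)
  qed
  also have "\<dots> = (\<Sum>l<N. \<bar>A i l\<bar> * (\<Sum>j<N. \<bar>A l j\<bar>))"
    by (subst sum.swap) (simp add: sum_distrib_left)
  also have "\<dots> \<le> (\<Sum>l<N. \<bar>A i l\<bar> * 1)"
    using A_row by (intro sum_mono mult_left_mono) auto
  also have "\<dots> \<le> 1" using A_row[OF assms] by simp
  finally show ?thesis .
qed

lemma A_sq_off_sym: "i < N \<Longrightarrow> j < N \<Longrightarrow> A_sq_off i j = A_sq_off j i"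
  unfolding A_sq_off_def using A_sym by (auto intro!: sum.cong simp: mult.commute)

text \<open>The first two conditions bound the gradient of the loss at the true parameter; the last two
  control the design matrix of local fields and covariates.\<close>

definition good :: "real \<Rightarrow> (nat \<Rightarrow> real) set" where
  "good u = {x. \<bar>affine_stat (\<lambda>_. 0) A x\<bar> < u \<and>
     (\<forall>k<d. \<bar>affine_stat (\<lambda>i. Z i k) (\<lambda>_ _. 0) x\<bar> < u) \<and>
     \<bar>affine_stat (\<lambda>_. 0) A_sq_off x\<bar> < u \<and>
     (\<forall>k<d. \<bar>affine_stat (local_field N A (\<lambda>j. Z j k)) (\<lambda>_ _. 0) x\<bar> < u)}"

text \<open>Union bound over \<open>2 * d + 2\<close> two-sided tails. The column sums of
  \<open>A_sq_off\<close> are row sums by symmetry, and applying \<open>A\<close> to a covariate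
  column preserves the bound \<open>M\<close> because the absolute row sums of \<open>A\<close> are
  at most 1.\<close>

lemma prob_good_ge:
  assumes Z: "\<And>i k. i < N \<Longrightarrow> k < d \<Longrightarrow> \<bar>Z i k\<bar> \<le> M"
    and pos: "u \<ge> 0" "N > 0" "M > 0"
  shows "prob (good u) \<ge> 1 - 4 * (real d + 1) * exp (- u\<^sup>2 / (16 * (M + 2) * (M + 1) * real N))"
proof -
  define p where "p = 2 * exp (- u\<^sup>2 / (16 * (M + 2) * (M + 1) * real N))"
  let ?E1 = "{x. u \<le> \<bar>affine_stat (\<lambda>_. 0) A x\<bar>}"
  let ?E2 = "\<lambda>k. {x. u \<le> \<bar>affine_stat (\<lambda>i. Z i k) (\<lambda>_ _. 0) x\<bar>}"
  let ?E3 = "{x. u \<le> \<bar>affine_stat (\<lambda>_. 0) A_sq_off x\<bar>}"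
  let ?E4 = "\<lambda>k. {x. u \<le> \<bar>affine_stat (local_field N A (\<lambda>j. Z j k)) (\<lambda>_ _. 0) x\<bar>}"
  have compl: "- good u = (?E1 \<union> (\<Union>k<d. ?E2 k)) \<union> (?E3 \<union> (\<Union>k<d. ?E4 k))"
    by (auto simp: good_def not_less)
  have e1: "prob ?E1 \<le> p"
    unfolding p_def by (rule affine_stat_tail) (use A_diag A_row A_col pos in auto)
  have e2: "prob (\<Union>k<d. ?E2 k) \<le> real d * p"
    unfolding p_def by (intro prob_UN_le affine_stat_tail) (use Z pos in auto)
  have col: "(\<Sum>j<N. \<bar>A_sq_off j i\<bar>) \<le> 1" if "i < N" for i
  proof -
    have "(\<Sum>j<N. \<bar>A_sq_off j i\<bar>) = (\<Sum>j<N. \<bar>A_sq_off i j\<bar>)"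
      using A_sq_off_sym that by (intro sum.cong) auto
    then show ?thesis using A_sq_off_row[OF that] by simp
  qed
  have e3: "prob ?E3 \<le> p"
    unfolding p_def
    by (rule affine_stat_tail) (use A_sq_off_row col pos in \<open>auto simp: A_sq_off_def[of _ i for i]\<close>)
  have AZ: "\<bar>local_field N A (\<lambda>j. Z j k) i\<bar> \<le> M" if "i < N" "k < d" for i k
    by (rule local_field_abs_le) (use Z that pos in auto)
  have e4: "prob (\<Union>k<d. ?E4 k) \<le> real d * p"
    unfolding p_def by (intro prob_UN_le affine_stat_tail) (use AZ pos in auto)
  have "prob (- good u) \<le> (p + real d * p) + (p + real d * p)"
    unfolding compl
    by (intro order_trans[OF prob_Un_le] add_mono e1 e2 e3 e4)
  also have "\<dots> = 4 * (real d + 1) * exp (- u\<^sup>2 / (16 * (M + 2) * (M + 1) * real N))"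
    by (simp add: p_def algebra_simps)
  finally show ?thesis by (simp add: prob_compl)
qed

section \<open>Lasso error bound on the good event\<close>

text \<open>The change of \<open>field\<close> when the parameter moves by
  \<open>(u, v)\<close>.\<close>

definition shift :: "(nat \<Rightarrow> real) \<Rightarrow> real \<Rightarrow> (nat \<Rightarrow> real) \<Rightarrow> nat \<Rightarrow> real" where
  "shift x u v i = u * local_field N A x i + (\<Sum>k<d. v k * Z i k)"

lemma local_field_adjoint:
  "(\<Sum>i<N. y i * local_field N A z i) = (\<Sum>i<N. local_field N A y i * z i)"
proof -
  have "(\<Sum>i<N. y i * local_field N A z i) = (\<Sum>i<N. \<Sum>j<N. A i j * y i * z j)"
    by (simp add: local_field_def sum_distrib_left mult_ac)
  also have "\<dots> = (\<Sum>j<N. \<Sum>i<N. A i j * y i * z j)" by (rule sum.swap)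
  also have "\<dots> = (\<Sum>j<N. \<Sum>i<N. A j i * y i * z j)"
    using A_sym by (intro sum.cong) auto
  also have "\<dots> = (\<Sum>i<N. local_field N A y i * z i)"
    by (simp add: local_field_def sum_distrib_right)
  finally show ?thesis .
qed

text \<open>Up to constants, each site contributes \<open>ln (cosh e) - x i * e\<close> to
  \<open>N\<close> times the loss, with derivative \<open>- resid x i\<close> at
  \<open>e = field x i\<close>. The first sum is the Bregman remainder of \<open>ln cosh\<close>,
  the second the linear term.\<close>

lemma loss_diff:
  assumes "N > 0"
  shows "real N * (pl_loss N d A Z x (\<beta> + u) (\<lambda>k. \<theta> k + v k) - pl_loss N d A Z x \<beta> \<theta>)
    = (\<Sum>i<N. ln (cosh (field x i + shift x u v i)) - ln (cosh (field x i)) - tanh (field x i) * shift x u v i)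
      - (\<Sum>i<N. resid x i * shift x u v i)"
proof -
  have e: "(\<beta> + u) * local_field N A x i + (\<Sum>k<d. (\<theta> k + v k) * Z i k) = field x i + shift x u v i" for i
    by (simp add: field_def shift_def algebra_simps sum.distrib)
  have "real N * (pl_loss N d A Z x (\<beta> + u) (\<lambda>k. \<theta> k + v k) - pl_loss N d A Z x \<beta> \<theta>)
    = (\<Sum>i<N. x i * field x i - ln (cosh (field x i)))
     - (\<Sum>i<N. x i * (field x i + shift x u v i) - ln (cosh (field x i + shift x u v i)))"
    unfolding pl_loss_def e field_def[symmetric] using assms by (simp add: field_simps)
  also have "\<dots> = (\<Sum>i<N. ln (cosh (field x i + shift x u v i)) - ln (cosh (field x i)) - tanh (field x i) * shift x u v i)
      - (\<Sum>i<N. resid x i * shift x u v i)"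
    by (simp add: resid_def algebra_simps sum_subtractf sum.distrib)
  finally show ?thesis .
qed

text \<open>Duality of the l1 and sup norms: the components of the score are the first two kinds of
  statistics in \<open>good\<close>.\<close>

lemma score_le:
  assumes "x \<in> good U"
  shows "(\<Sum>i<N. resid x i * shift x u v i) \<le> U * (\<bar>u\<bar> + (\<Sum>k<d. \<bar>v k\<bar>))"
proof -
  have "(\<Sum>i<N. resid x i * shift x u v i)
      = u * affine_stat (\<lambda>_. 0) A x + (\<Sum>i<N. \<Sum>k<d. v k * (Z i k * resid x i))"
    by (simp add: shift_def affine_stat_def algebra_simps sum.distrib sum_distrib_left)
  also have "(\<Sum>i<N. \<Sum>k<d. v k * (Z i k * resid x i)) = (\<Sum>k<d. \<Sum>i<N. v k * (Z i k * resid x i))"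
    by (rule sum.swap)
  also have "\<dots> = (\<Sum>k<d. v k * affine_stat (\<lambda>i. Z i k) (\<lambda>_ _. 0) x)"
    by (simp add: affine_stat_def local_field_def sum_distrib_left)
  also have "u * affine_stat (\<lambda>_. 0) A x + (\<Sum>k<d. v k * affine_stat (\<lambda>i. Z i k) (\<lambda>_ _. 0) x)
      \<le> \<bar>u\<bar> * U + (\<Sum>k<d. \<bar>v k\<bar> * U)"
  proof (intro add_mono sum_mono)
    have mult_le: "a * b \<le> \<bar>a\<bar> * U" if "\<bar>b\<bar> < U" for a b
    proof -
      have "a * b \<le> \<bar>a\<bar> * \<bar>b\<bar>" by (metis abs_ge_self abs_mult)
      also have "\<dots> \<le> \<bar>a\<bar> * U" using that by (intro mult_left_mono) auto
      finally show ?thesis .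
    qed
    show "u * affine_stat (\<lambda>_. 0) A x \<le> \<bar>u\<bar> * U"
      by (rule mult_le) (use assms in \<open>simp add: good_def\<close>)
    show "v k * affine_stat (\<lambda>i. Z i k) (\<lambda>_ _. 0) x \<le> \<bar>v k\<bar> * U" if "k \<in> {..<d}" for k
      by (rule mult_le) (use assms that in \<open>simp add: good_def\<close>)
  qed
  also have "\<dots> = U * (\<bar>u\<bar> + (\<Sum>k<d. \<bar>v k\<bar>))"
    by (simp add: algebra_simps sum_distrib_left)
  finally show ?thesis .
qed

lemma A_sq_decomp:
  assumes "i < N"
  shows "local_field N A (local_field N A x) i
       = (\<Sum>l<N. (A i l)\<^sup>2) * x i + local_field N A_sq_off x i"
proof -
  have "local_field N A (local_field N A x) i = (\<Sum>l<N. \<Sum>j<N. A i l * A l j * x j)"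
    by (simp add: local_field_def sum_distrib_left mult.assoc)
  also have "\<dots> = (\<Sum>j<N. (\<Sum>l<N. A i l * A l j) * x j)"
    by (subst sum.swap) (simp add: sum_distrib_right)
  also have "\<dots> = (\<Sum>j<N. A_sq_off i j * x j + (if j = i then (\<Sum>l<N. A i l * A l i) * x i else 0))"
    by (intro sum.cong) (auto simp: A_sq_off_def)
  also have "\<dots> = local_field N A_sq_off x i + (\<Sum>l<N. A i l * A l i) * x i"
    using assms by (simp add: sum.distrib local_field_def)
  also have "(\<Sum>l<N. A i l * A l i) = (\<Sum>l<N. (A i l)\<^sup>2)"
    using A_sym assms by (intro sum.cong) (auto simp: power2_eq_square)
  finally show ?thesis by simp
qed

text \<open>Testing the vector of shifts against \<open>A r\<close>, \<open>r\<close> the residuals, isolates \<open>u\<close>: the pairing of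
  \<open>A x\<close> with \<open>A r\<close> has a diagonal part of order \<open>N\<close>, and all the rest is conditionally centred.\<close>

lemma shift_pairing_ge:
  assumes x: "x \<in> spins N" "x \<in> good U"
    and K: "\<And>i. i < N \<Longrightarrow> \<bar>field x i\<bar> \<le> K"
  shows "\<bar>u\<bar> * ((1 - tanh K) * (\<Sum>i<N. \<Sum>j<N. (A i j)\<^sup>2) - U) - U * (\<Sum>k<d. \<bar>v k\<bar>)
      \<le> 2 * sqrt (real N) * L2_set (shift x u v) {..<N}"
proof -
  define w where "w = local_field N A (resid x)"
  have w: "\<bar>w i\<bar> \<le> 2" if "i < N" for i
    unfolding w_def using that resid_abs_le x(1) by (intro local_field_abs_le) auto
  define P where "P = (\<Sum>i<N. local_field N A x i * w i)"
  define R where "R = (\<lambda>k. \<Sum>i<N. Z i k * w i)"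
  have R: "\<bar>R k\<bar> \<le> U" if "k < d" for k
  proof -
    \<comment> \<open>Self-adjointness moves \<open>A\<close> from the residuals onto the covariate
      column, which gives the last family in \<open>good\<close>.\<close>
    have "R k = affine_stat (local_field N A (\<lambda>j. Z j k)) (\<lambda>_ _. 0) x"
      unfolding R_def w_def local_field_adjoint
      by (simp add: affine_stat_def local_field_def[of N "\<lambda>_ _. 0"])
    then show ?thesis using x that by (auto simp: good_def intro: less_imp_le)
  qed
  have P: "(1 - tanh K) * (\<Sum>i<N. \<Sum>j<N. (A i j)\<^sup>2) - U \<le> P"
  proof -
    \<comment> \<open>Moving \<open>A\<close> across pairs the residuals with \<open>A\<close>
      applied twice to \<open>x\<close>. The diagonal part of that is the main term, the
      off-diagonal part the third statistic in \<open>good\<close>.\<close>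
    have "P = (\<Sum>i<N. local_field N A (local_field N A x) i * resid x i)"
      unfolding P_def w_def by (rule local_field_adjoint)
    also have "\<dots> = (\<Sum>i<N. (\<Sum>l<N. (A i l)\<^sup>2) * (x i * resid x i)) + affine_stat (\<lambda>_. 0) A_sq_off x"
      by (simp add: A_sq_decomp affine_stat_def sum.distrib algebra_simps)
    also have "\<dots> \<ge> (\<Sum>i<N. (\<Sum>l<N. (A i l)\<^sup>2) * (1 - tanh K)) - U"
    proof -
      have "(1 - tanh K) \<le> x i * resid x i" if i: "i < N" for i
      proof -
        have "\<bar>tanh (field x i)\<bar> \<le> tanh K" using K[OF i] by (rule tanh_abs_mono)
        moreover have "x i = 1 \<or> x i = -1" using x i by (auto simp: spins_def)
        ultimately show ?thesis by (auto simp: resid_def simp del: tanh_real_le_iff)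
      qed
      then have "(\<Sum>i<N. (\<Sum>l<N. (A i l)\<^sup>2) * (1 - tanh K)) \<le> (\<Sum>i<N. (\<Sum>l<N. (A i l)\<^sup>2) * (x i * resid x i))"
        by (intro sum_mono mult_left_mono sum_nonneg) auto
      moreover have "- U \<le> affine_stat (\<lambda>_. 0) A_sq_off x"
        using x by (auto simp: good_def)
      ultimately show ?thesis by linarith
    qed
    finally show ?thesis by (simp add: sum_distrib_left mult.commute)
  qed
  have "(\<Sum>i<N. shift x u v i * w i) = u * P + (\<Sum>i<N. \<Sum>k<d. v k * (Z i k * w i))"
    by (simp add: shift_def P_def algebra_simps sum.distrib sum_distrib_left)
  also have "(\<Sum>i<N. \<Sum>k<d. v k * (Z i k * w i)) = (\<Sum>k<d. v k * R k)"
    by (subst sum.swap) (simp add: R_def sum_distrib_left)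
  finally have pair: "(\<Sum>i<N. shift x u v i * w i) = u * P + (\<Sum>k<d. v k * R k)" .
  have "\<bar>\<Sum>k<d. v k * R k\<bar> \<le> (\<Sum>k<d. \<bar>v k * R k\<bar>)" by (rule sum_abs)
  also have "\<dots> \<le> (\<Sum>k<d. \<bar>v k\<bar> * U)"
    unfolding abs_mult using R by (intro sum_mono mult_left_mono) auto
  also have "\<dots> = U * (\<Sum>k<d. \<bar>v k\<bar>)"
    by (simp add: sum_distrib_left mult.commute)
  finally have vR: "\<bar>\<Sum>k<d. v k * R k\<bar> \<le> U * (\<Sum>k<d. \<bar>v k\<bar>)" .
  have "\<bar>u\<bar> * ((1 - tanh K) * (\<Sum>i<N. \<Sum>j<N. (A i j)\<^sup>2) - U) \<le> \<bar>u\<bar> * \<bar>P\<bar>"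
    using P by (intro mult_left_mono) auto
  also have "\<dots> = \<bar>u * P\<bar>" by (simp add: abs_mult)
  also have "\<dots> \<le> \<bar>\<Sum>i<N. shift x u v i * w i\<bar> + U * (\<Sum>k<d. \<bar>v k\<bar>)"
    using vR pair by linarith
  also have "\<bar>\<Sum>i<N. shift x u v i * w i\<bar> \<le> (\<Sum>i<N. \<bar>shift x u v i\<bar> * \<bar>w i\<bar>)"
    by (rule order_trans[OF sum_abs]) (simp add: abs_mult)
  also have "\<dots> \<le> L2_set (shift x u v) {..<N} * L2_set w {..<N}"
    by (rule L2_set_mult_ineq)
  also have "\<dots> \<le> L2_set (shift x u v) {..<N} * (2 * sqrt (real N))"
  proof (rule mult_left_mono)
    have "(\<Sum>i<N. (w i)\<^sup>2) \<le> (\<Sum>i<N. 4)"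
    proof (rule sum_mono)
      fix i assume "i \<in> {..<N}"
      then have "\<bar>w i\<bar>\<^sup>2 \<le> 2\<^sup>2" using w by (intro power_mono) auto
      then show "(w i)\<^sup>2 \<le> 4" by simp
    qed
    then have "sqrt (\<Sum>i<N. (w i)\<^sup>2) \<le> sqrt (4 * real N)"
      by (intro real_sqrt_le_mono) simp
    then show "L2_set w {..<N} \<le> 2 * sqrt (real N)"
      by (simp add: L2_set_def real_sqrt_mult)
  qed simp
  finally show ?thesis by (simp add: mult.commute)
qed

text \<open>Triangle inequality: the covariate part is the shift minus \<open>u\<close> times the
  local fields, and local fields are at most 1 in modulus.\<close>

lemma shift_norm_ge:
  assumes x: "x \<in> spins N" and c: "c \<ge> 0"
    and gram: "c * real N * (\<Sum>k<d. (v k)\<^sup>2) \<le> (\<Sum>i<N. (\<Sum>k<d. v k * Z i k)\<^sup>2)"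
  shows "sqrt (real N) * (sqrt c * L2_set v {..<d} - \<bar>u\<bar>) \<le> L2_set (shift x u v) {..<N}"
proof -
  let ?m = "\<lambda>i. - u * local_field N A x i"
  have "sqrt (real N) * (sqrt c * L2_set v {..<d}) = sqrt (c * real N * (\<Sum>k<d. (v k)\<^sup>2))"
    by (simp add: L2_set_def real_sqrt_mult)
  also have "\<dots> \<le> L2_set (\<lambda>i. \<Sum>k<d. v k * Z i k) {..<N}"
    unfolding L2_set_def by (rule real_sqrt_le_mono[OF gram])
  also have "\<dots> = L2_set (\<lambda>i. shift x u v i + ?m i) {..<N}"
    by (simp add: shift_def)
  also have "\<dots> \<le> L2_set (shift x u v) {..<N} + L2_set ?m {..<N}"
    by (rule L2_set_triangle_ineq)
  also have "L2_set ?m {..<N} \<le> \<bar>u\<bar> * sqrt (real N)"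
  proof -
    have "(\<Sum>i<N. (?m i)\<^sup>2) \<le> (\<Sum>i<N. u\<^sup>2)"
    proof (rule sum_mono)
      fix i assume "i \<in> {..<N}"
      then have "\<bar>local_field N A x i\<bar> \<le> 1"
        using x by (intro local_field_abs_le) (auto simp: spins_abs)
      then have "\<bar>?m i\<bar> \<le> \<bar>u\<bar>"
        by (simp add: abs_mult mult_left_le)
      then show "(?m i)\<^sup>2 \<le> u\<^sup>2" by (simp only: abs_le_square_iff)
    qed
    then have "sqrt (\<Sum>i<N. (?m i)\<^sup>2) \<le> sqrt (u\<^sup>2 * real N)"
      by (intro real_sqrt_le_mono) (simp add: mult.commute)
    then show ?thesis by (simp add: L2_set_def real_sqrt_mult)
  qed
  finally show ?thesis by (simp add: algebra_simps)
qed

text \<open>Only the at most \<open>s\<close> nonzero coordinates of \<theta> contribute, so the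
  bound does not grow with \<open>d\<close>. It supplies the constant \<open>K\<close> uniformly in
  the sample size.\<close>

lemma field_abs_le:
  assumes x: "x \<in> spins N" and i: "i < N"
    and \<theta>: "\<And>k. k < d \<Longrightarrow> \<bar>\<theta> k\<bar> \<le> \<Theta>" and Z: "\<And>k. k < d \<Longrightarrow> \<bar>Z i k\<bar> \<le> M"
    and card: "card {k. k < d \<and> \<theta> k \<noteq> 0} \<le> s" and pos: "\<Theta> \<ge> 0" "M \<ge> 0"
  shows "\<bar>field x i\<bar> \<le> 1 + real s * (\<Theta> * M)"
proof -
  have "\<bar>local_field N A x i\<bar> \<le> 1"
    using x i by (intro local_field_abs_le) (auto simp: spins_abs)
  then have "\<bar>\<beta> * local_field N A x i\<bar> \<le> 1 * 1"
    unfolding abs_mult using beta_le by (intro mult_mono) auto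
  moreover have "\<bar>\<Sum>k<d. \<theta> k * Z i k\<bar> \<le> real s * (\<Theta> * M)"
  proof -
    have "(\<Sum>k<d. \<theta> k * Z i k) = (\<Sum>k\<in>{k. k < d \<and> \<theta> k \<noteq> 0}. \<theta> k * Z i k)"
      by (intro sum.mono_neutral_right) auto
    also have "\<bar>\<dots>\<bar> \<le> (\<Sum>k\<in>{k. k < d \<and> \<theta> k \<noteq> 0}. \<bar>\<theta> k * Z i k\<bar>)"
      by (rule sum_abs)
    also have "\<dots> \<le> (\<Sum>k\<in>{k. k < d \<and> \<theta> k \<noteq> 0}. \<Theta> * M)"
      unfolding abs_mult using \<theta> Z pos by (intro sum_mono mult_mono) auto
    also have "\<dots> \<le> real s * (\<Theta> * M)"
      using card pos by (simp add: mult_right_mono)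
    finally show ?thesis .
  qed
  ultimately show ?thesis
    unfolding field_def by linarith
qed

text \<open>Off the support of \<theta> the penalty grows by the full
  \<open>\<bar>v k\<bar>\<close>; on it the penalty drops by at most that much. The coordinate of
  \<beta> is always counted as part of the support.\<close>

lemma penalty_gain_le:
  "l1_norm d \<beta> \<theta> - l1_norm d (\<beta> + u) (\<lambda>k. \<theta> k + v k)
    \<le> 2 * (\<bar>u\<bar> + (\<Sum>k<d. if \<theta> k \<noteq> 0 then \<bar>v k\<bar> else 0)) - (\<bar>u\<bar> + (\<Sum>k<d. \<bar>v k\<bar>))"
proof -
  have "(\<Sum>k<d. \<bar>\<theta> k\<bar>) - (\<Sum>k<d. \<bar>\<theta> k + v k\<bar>)
      \<le> (\<Sum>k<d. 2 * (if \<theta> k \<noteq> 0 then \<bar>v k\<bar> else 0) - \<bar>v k\<bar>)"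
  proof -
    have "\<bar>\<theta> k\<bar> - \<bar>\<theta> k + v k\<bar> \<le> 2 * (if \<theta> k \<noteq> 0 then \<bar>v k\<bar> else 0) - \<bar>v k\<bar>" for k
      by (cases "\<theta> k = 0") simp_all
    then show ?thesis
      by (subst sum_subtractf[symmetric]) (rule sum_mono)
  qed
  also have "\<dots> = 2 * (\<Sum>k<d. if \<theta> k \<noteq> 0 then \<bar>v k\<bar> else 0) - (\<Sum>k<d. \<bar>v k\<bar>)"
    by (simp add: sum_subtractf sum_distrib_left)
  finally have *: "(\<Sum>k<d. \<bar>\<theta> k\<bar>) - (\<Sum>k<d. \<bar>\<theta> k + v k\<bar>)
      \<le> 2 * (\<Sum>k<d. if \<theta> k \<noteq> 0 then \<bar>v k\<bar> else 0) - (\<Sum>k<d. \<bar>v k\<bar>)" .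
  have "\<bar>\<beta>\<bar> + a - (\<bar>\<beta> + u\<bar> + b) \<le> 2 * (\<bar>u\<bar> + t) - (\<bar>u\<bar> + w)"
    if "a - b \<le> 2 * t - w" for a b t w :: real
    using that abs_triangle_ineq4[of "\<beta> + u" u] by simp
  from this[OF *] show ?thesis
    unfolding l1_norm_def .
qed

text \<open>The minimiser does at least as well as the true parameter. On the good event the score
  is at most half the penalty level, so it uses up half of the negative term and
  \<open>2 * T - V\<close> becomes \<open>2 * T - V / 2\<close>.\<close>

lemma lasso_basic_inequality:
  assumes N: "N > 0" and x: "x \<in> good (real N * lam / 2)" and lam: "lam \<ge> 0"
    and sup: "supported d \<theta>" and min: "is_pl_minimizer N d A Z lam x (\<beta> + u, \<lambda>k. \<theta> k + v k)"
  shows "(\<Sum>i<N. ln (cosh (field x i + shift x u v i)) - ln (cosh (field x i)) - tanh (field x i) * shift x u v i)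
    \<le> real N * lam * (2 * (\<bar>u\<bar> + (\<Sum>k<d. if \<theta> k \<noteq> 0 then \<bar>v k\<bar> else 0)) - (\<bar>u\<bar> + (\<Sum>k<d. \<bar>v k\<bar>)) / 2)"
    (is "?H \<le> real N * lam * (2 * ?T - ?V / 2)")
proof -
  have "pl_objective N d A Z lam x (\<beta> + u) (\<lambda>k. \<theta> k + v k) \<le> pl_objective N d A Z lam x \<beta> \<theta>"
    using min sup by (simp add: is_pl_minimizer_def)
  then have "pl_loss N d A Z x (\<beta> + u) (\<lambda>k. \<theta> k + v k) - pl_loss N d A Z x \<beta> \<theta>
      \<le> lam * (l1_norm d \<beta> \<theta> - l1_norm d (\<beta> + u) (\<lambda>k. \<theta> k + v k))"
    by (simp add: pl_objective_def algebra_simps)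
  also have "\<dots> \<le> lam * (2 * ?T - ?V)"
    using lam by (intro mult_left_mono penalty_gain_le)
  finally have "real N * (pl_loss N d A Z x (\<beta> + u) (\<lambda>k. \<theta> k + v k) - pl_loss N d A Z x \<beta> \<theta>)
      \<le> real N * (lam * (2 * ?T - ?V))"
    by (rule mult_left_mono) simp
  moreover have "H \<le> real N * lam * (2 * t - w / 2)"
    if "b \<le> real N * (lam * (2 * t - w))" "b = H - r" "r \<le> real N * lam / 2 * w" for b H r t w :: real
    using that by (simp add: algebra_simps)
  ultimately show ?thesis
    using loss_diff[OF N, of x u v] score_le[OF x, of u v] by blast
qed

text \<open>The deterministic core. With \<open>n\<close> the error and \<open>D\<close> the root
  mean square of the shifts, the cone condition bounds the l1 error by \<open>4 * q * n\<close>, the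
  two lower bounds on the shifts give \<open>n \<le> \<kappa> * D\<close>, and the convexity
  remainder bounds the square of \<open>D\<close> by a multiple of
  \<open>lam * n * (1 + R * n)\<close>. The three smallness conditions absorb the error
  terms.\<close>

lemma estimator_error:
  fixes s :: nat and cA cZ K M lam :: real
  defines "q \<equiv> 1 + sqrt (real s)"
  defines "c1 \<equiv> (1 - tanh K) * cA"
  defines "c2 \<equiv> (1 - (tanh (K + 1))\<^sup>2) / 2"
  defines "\<kappa> \<equiv> 2 * (1 / sqrt cZ + (1 + 1 / sqrt cZ) * (4 / c1))"
  assumes x: "x \<in> spins N" "x \<in> good (real N * lam / 2)" and N: "N > 0" and lam: "lam > 0"
    and K: "\<And>i. i < N \<Longrightarrow> \<bar>field x i\<bar> \<le> K"
    and F: "cA * real N \<le> (\<Sum>i<N. \<Sum>j<N. (A i j)\<^sup>2)" and cA: "cA > 0"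
    and gram: "\<And>v. cZ * real N * (\<Sum>k<d. (v k)\<^sup>2) \<le> (\<Sum>i<N. (\<Sum>k<d. v k * Z i k)\<^sup>2)" and cZ: "cZ > 0"
    and Z: "\<And>i k. i < N \<Longrightarrow> k < d \<Longrightarrow> \<bar>Z i k\<bar> \<le> M" and M: "M > 0"
    and card: "card {k. k < d \<and> \<theta> k \<noteq> 0} \<le> s"
    and sup: "supported d \<theta>" and min: "is_pl_minimizer N d A Z lam x est"
    and small1: "lam \<le> c1" and small2: "(1 + 1 / sqrt cZ) * (lam * (4 * q) / c1) \<le> 1 / 2"
    and small3: "2 * lam * q * ((1 + M) * (4 * q)) \<le> c2 / (2 * \<kappa>\<^sup>2)"
  shows "l2_dist d est \<beta> \<theta> \<le> 4 * q * \<kappa>\<^sup>2 / c2 * lam"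
proof -
  define u where "u = fst est - \<beta>"
  define v where "v = (\<lambda>k. snd est k - \<theta> k)"
  have est: "est = (\<beta> + u, \<lambda>k. \<theta> k + v k)"
    by (simp add: u_def v_def)
  define n where "n = l2_dist d est \<beta> \<theta>"
  define nv where "nv = L2_set v {..<d}"
  define T where "T = \<bar>u\<bar> + (\<Sum>k<d. if \<theta> k \<noteq> 0 then \<bar>v k\<bar> else 0)"
  define V where "V = \<bar>u\<bar> + (\<Sum>k<d. \<bar>v k\<bar>)"
  define S where "S = (\<Sum>i<N. (shift x u v i)\<^sup>2)"
  define D where "D = L2_set (shift x u v) {..<N} / sqrt (real N)"
  define h where "h = (\<lambda>i. ln (cosh (field x i + shift x u v i)) - ln (cosh (field x i)) - tanh (field x i) * shift x u v i)"
  have c1: "c1 > 0"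
    unfolding c1_def using cA tanh_real_bounds[of K] by simp
  have c2: "c2 > 0"
  proof -
    have "\<bar>tanh (K + 1)\<bar> < 1" using tanh_real_bounds[of "K + 1"] by auto
    then show ?thesis by (simp add: c2_def abs_square_less_1 del: tanh_real_abs)
  qed
  have q: "q \<ge> 1" by (simp add: q_def)
  have n_eq: "n = sqrt (u\<^sup>2 + nv\<^sup>2)"
    by (simp add: n_def nv_def l2_dist_def u_def v_def L2_set_def sum_nonneg)
  have nv: "nv \<ge> 0" by (simp add: nv_def)
  have n0: "n \<ge> 0" by (simp add: n_eq)
  have u_le: "\<bar>u\<bar> \<le> n" and nv_le: "nv \<le> n" and n_le: "n \<le> \<bar>u\<bar> + nv"
    using nv real_sqrt_ge_abs1[of u nv] real_sqrt_ge_abs2[of nv u] sqrt_sum_squares_le_sum_abs[of u nv]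
    by (auto simp: n_eq)
  have T_le: "T \<le> q * n"
  proof -
    have "T \<le> \<bar>u\<bar> + sqrt (real s) * nv"
      unfolding T_def nv_def using sparse_l1_le_l2[OF card, of v] by simp
    also have "\<dots> \<le> n + sqrt (real s) * n"
      using u_le nv_le by (intro add_mono mult_left_mono) auto
    finally show ?thesis by (simp add: q_def algebra_simps)
  qed
  have basic: "(\<Sum>i<N. h i) \<le> real N * lam * (2 * T - V / 2)"
    unfolding h_def T_def V_def
    by (rule lasso_basic_inequality[OF N x(2) _ sup]) (use min est lam in auto)
  have h_ge: "c2 * ((shift x u v i)\<^sup>2 / (1 + \<bar>shift x u v i\<bar>)) \<le> h i" if "i < N" for i
    unfolding c2_def h_def using ln_cosh_remainder_ge[OF K[OF that], of "shift x u v i"] by simp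
  have "0 \<le> (\<Sum>i<N. h i)"
  proof (rule sum_nonneg)
    fix i assume "i \<in> {..<N}"
    then have "c2 * ((shift x u v i)\<^sup>2 / (1 + \<bar>shift x u v i\<bar>)) \<le> h i" using h_ge by simp
    moreover have "0 \<le> c2 * ((shift x u v i)\<^sup>2 / (1 + \<bar>shift x u v i\<bar>))" using c2 by simp
    ultimately show "0 \<le> h i" by linarith
  qed
  with basic have "0 \<le> real N * lam * (2 * T - V / 2)" by linarith
  \<comment> \<open>Nonnegativity of the convexity remainder forces the error into the lasso
    cone.\<close>
  then have "0 \<le> 2 * T - V / 2"
    using N lam by (smt (verit) mult_pos_neg mult_pos_pos of_nat_0_less_iff)
  then have V_le: "V \<le> 4 * q * n" using T_le by linarith
  have V0: "V \<ge> 0" by (simp add: V_def sum_nonneg)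
  have H_le: "(\<Sum>i<N. h i) \<le> real N * lam * (2 * (q * n))"
    using basic T_le V0 N lam by (intro order_trans[OF basic] mult_left_mono) auto
  \<comment> \<open>At this point \<open>n\<close> has no a priori bound, so the shifts are only
    controlled by \<open>R * n\<close>. The resulting factor \<open>1 + R * n\<close> is carried
    along until \<open>small3\<close> absorbs it.\<close>
  define R where "R = (1 + M) * (4 * q)"
  have R: "R > 0" using M q by (simp add: R_def)
  have shift_le: "\<bar>shift x u v i\<bar> \<le> R * n" if i: "i < N" for i
  proof -
    have "\<bar>local_field N A x i\<bar> \<le> 1"
      using x i by (intro local_field_abs_le) (auto simp: spins_abs)
    then have a: "\<bar>u * local_field N A x i\<bar> \<le> \<bar>u\<bar>"
      by (simp add: abs_mult mult_left_le)
    have "\<bar>\<Sum>k<d. v k * Z i k\<bar> \<le> (\<Sum>k<d. \<bar>v k * Z i k\<bar>)" by (rule sum_abs)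
    also have "\<dots> \<le> (\<Sum>k<d. \<bar>v k\<bar> * M)"
      unfolding abs_mult using Z i by (intro sum_mono mult_left_mono) auto
    also have "\<dots> = M * (\<Sum>k<d. \<bar>v k\<bar>)" by (simp add: sum_distrib_left mult.commute)
    finally have b: "\<bar>\<Sum>k<d. v k * Z i k\<bar> \<le> M * (\<Sum>k<d. \<bar>v k\<bar>)" .
    have "\<bar>shift x u v i\<bar> \<le> \<bar>u\<bar> + M * (\<Sum>k<d. \<bar>v k\<bar>)"
      unfolding shift_def using a b by linarith
    also have "\<dots> \<le> (1 + M) * V"
      using M by (simp add: V_def algebra_simps sum_nonneg)
    also have "\<dots> \<le> (1 + M) * (4 * q * n)"
      using V_le M by (intro mult_left_mono) auto
    finally show ?thesis by (simp add: R_def mult.assoc)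
  qed
  have S_eq: "S = real N * D\<^sup>2"
    using N by (simp add: S_def D_def L2_set_def power_divide sum_nonneg)
  have L_eq: "L2_set (shift x u v) {..<N} = sqrt (real N) * D"
    using N by (simp add: D_def)
  have u_D: "\<bar>u\<bar> \<le> 4 / c1 * D + lam * (4 * q) / c1 * n"
  proof -
    have V1: "(\<Sum>k<d. \<bar>v k\<bar>) \<le> 4 * q * n" using V_le by (simp add: V_def)
    have "c1 * real N \<le> (1 - tanh K) * (\<Sum>i<N. \<Sum>j<N. (A i j)\<^sup>2)"
      unfolding c1_def mult.assoc using F tanh_real_bounds[of K] by (intro mult_left_mono) auto
    \<comment> \<open>By \<open>small1\<close> the noise level takes away at most half of the
      diagonal term.\<close>
    moreover have "real N * lam / 2 \<le> c1 * real N / 2"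
      using small1 by (simp add: mult.commute[of "real N"] mult_right_mono)
    ultimately have "c1 * real N / 2 \<le> (1 - tanh K) * (\<Sum>i<N. \<Sum>j<N. (A i j)\<^sup>2) - real N * lam / 2"
      by linarith
    then have "\<bar>u\<bar> * (c1 * real N / 2)
        \<le> \<bar>u\<bar> * ((1 - tanh K) * (\<Sum>i<N. \<Sum>j<N. (A i j)\<^sup>2) - real N * lam / 2)"
      by (intro mult_left_mono) auto
    also have "\<dots> \<le> 2 * sqrt (real N) * (sqrt (real N) * D) + real N * lam / 2 * (\<Sum>k<d. \<bar>v k\<bar>)"
      using shift_pairing_ge[OF x K, of u v] by (simp add: L_eq)
    also have "2 * sqrt (real N) * (sqrt (real N) * D) = real N * (2 * D)"
      by simp
    also have "real N * (2 * D) + real N * lam / 2 * (\<Sum>k<d. \<bar>v k\<bar>)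
        \<le> real N * (2 * D) + real N * lam / 2 * (4 * q * n)"
      using V1 lam by (intro add_left_mono mult_left_mono) auto
    finally have "real N * (\<bar>u\<bar> * c1) \<le> real N * (4 * D + lam * (4 * q) * n)"
      by (simp add: algebra_simps)
    then have "\<bar>u\<bar> * c1 \<le> 4 * D + lam * (4 * q) * n"
      using N by simp
    then have "\<bar>u\<bar> \<le> (4 * D + lam * (4 * q) * n) / c1"
      using c1 by (simp add: pos_le_divide_eq)
    then show ?thesis by (simp add: add_divide_distrib)
  qed
  have nv_D: "nv \<le> (D + \<bar>u\<bar>) / sqrt cZ"
  proof -
    have "sqrt (real N) * (sqrt cZ * nv - \<bar>u\<bar>) \<le> sqrt (real N) * D"
      using shift_norm_ge[OF x(1) _ gram, of v u] cZ by (simp add: L_eq nv_def)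
    then have "sqrt cZ * nv - \<bar>u\<bar> \<le> D" using N by simp
    then show ?thesis using cZ by (simp add: pos_le_divide_eq mult.commute)
  qed
  have n_D: "n \<le> \<kappa> * D"
  proof -
    have "n \<le> \<bar>u\<bar> + (D + \<bar>u\<bar>) / sqrt cZ" using n_le nv_D by linarith
    also have "\<dots> = 1 / sqrt cZ * D + (1 + 1 / sqrt cZ) * \<bar>u\<bar>"
      by (simp add: algebra_simps add_divide_distrib)
    also have "\<dots> \<le> 1 / sqrt cZ * D + (1 + 1 / sqrt cZ) * (4 / c1 * D + lam * (4 * q) / c1 * n)"
      using u_D cZ by (intro add_left_mono mult_left_mono) auto
    also have "\<dots> = \<kappa> / 2 * D + (1 + 1 / sqrt cZ) * (lam * (4 * q) / c1) * n"
    proof -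
      have "a * D + b * (e * D + g * n) = 2 * (a + b * e) / 2 * D + b * g * n" for a b e g :: real
        by (simp add: algebra_simps)
      then show ?thesis unfolding \<kappa>_def .
    qed
    \<comment> \<open>Absorbing \<open>n / 2\<close> on the left doubles the constant, which is the
      leading factor 2 in \<open>\<kappa>\<close>.\<close>
    also have "\<dots> \<le> \<kappa> / 2 * D + 1 / 2 * n"
      using small2 n0 by (intro add_left_mono mult_right_mono) auto
    finally show ?thesis by simp
  qed
  have \<kappa>: "\<kappa> > 0"
    unfolding \<kappa>_def using c1 cZ by (intro mult_pos_pos add_pos_pos) auto
  have "real N * n\<^sup>2 \<le> \<kappa>\<^sup>2 * S"
  proof -
    have "n\<^sup>2 \<le> (\<kappa> * D)\<^sup>2" using n_D n0 by (rule power_mono)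
    then show ?thesis
      by (simp add: S_eq power_mult_distrib mult.left_commute mult_left_mono)
  qed
  moreover have "c2 * S \<le> (1 + R * n) * (real N * lam * (2 * (q * n)))"
  proof -
    have "c2 * S / (1 + R * n) = (\<Sum>i<N. c2 * ((shift x u v i)\<^sup>2 / (1 + R * n)))"
      by (simp add: S_def sum_distrib_left sum_divide_distrib)
    also have "\<dots> \<le> (\<Sum>i<N. h i)"
    proof (rule sum_mono)
      fix i assume "i \<in> {..<N}"
      then have i: "i < N" by simp
      have "c2 * ((shift x u v i)\<^sup>2 / (1 + R * n)) \<le> c2 * ((shift x u v i)\<^sup>2 / (1 + \<bar>shift x u v i\<bar>))"
        using shift_le[OF i] c2 by (intro mult_left_mono divide_left_mono mult_pos_pos) auto
      also have "\<dots> \<le> h i" by (rule h_ge[OF i])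
      finally show "c2 * ((shift x u v i)\<^sup>2 / (1 + R * n)) \<le> h i" .
    qed
    also note H_le
    finally show ?thesis
      using R n0 by (simp add: pos_divide_le_eq add_pos_nonneg mult.commute)
  qed
  ultimately have "c2 * (real N * n\<^sup>2) \<le> \<kappa>\<^sup>2 * ((1 + R * n) * (real N * lam * (2 * (q * n))))"
  proof -
    assume a: "real N * n\<^sup>2 \<le> \<kappa>\<^sup>2 * S" and b: "c2 * S \<le> (1 + R * n) * (real N * lam * (2 * (q * n)))"
    have "c2 * (real N * n\<^sup>2) \<le> c2 * (\<kappa>\<^sup>2 * S)" using a c2 by (intro mult_left_mono) auto
    also have "\<dots> = \<kappa>\<^sup>2 * (c2 * S)" by simp
    also have "\<dots> \<le> \<kappa>\<^sup>2 * ((1 + R * n) * (real N * lam * (2 * (q * n))))"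
      using b by (intro mult_left_mono) auto
    finally show ?thesis .
  qed
  then have main: "real N * n * (c2 * n) \<le> real N * n * (\<kappa>\<^sup>2 * ((1 + R * n) * (lam * (2 * q))))"
    by (simp add: power2_eq_square mult_ac)
  show ?thesis
  proof (cases "n = 0")
    case True
    then show ?thesis using c2 q lam by (simp add: n_def[symmetric])
  next
    case False
    then have "n > 0" using n0 by simp
    then have "c2 * n \<le> \<kappa>\<^sup>2 * ((1 + R * n) * (lam * (2 * q)))"
      using main N by (subst (asm) mult_le_cancel_left_pos) auto
    also have "\<dots> = \<kappa>\<^sup>2 * (2 * lam * q) + \<kappa>\<^sup>2 * (2 * lam * q * R) * n"
      by (simp add: algebra_simps)
    \<comment> \<open>By \<open>small3\<close> the part of the bound quadratic in the error, already
      divided by \<open>n\<close>, is at most \<open>c2 / 2 * n\<close> and moves to the left-hand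
      side.\<close>
    also have "\<dots> \<le> \<kappa>\<^sup>2 * (2 * lam * q) + \<kappa>\<^sup>2 * (c2 / (2 * \<kappa>\<^sup>2)) * n"
      using small3 n0 unfolding R_def by (intro add_left_mono mult_right_mono mult_left_mono) auto
    also have "\<kappa>\<^sup>2 * (c2 / (2 * \<kappa>\<^sup>2)) = c2 / 2" using \<kappa> by simp
    finally have "n * c2 \<le> 4 * q * \<kappa>\<^sup>2 * lam" by (simp add: algebra_simps)
    then have "n \<le> 4 * q * \<kappa>\<^sup>2 * lam / c2" using c2 by (simp add: pos_le_divide_eq)
    then show ?thesis by (simp add: n_def)
  qed
qed

end

section \<open>Choice of the constants and passage to the limit\<close>

theorem mainTheorem19:
  fixes \<Theta> M \<beta> cA cZ :: real and s0 :: nat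
  assumes "\<Theta> > 0" and "M > 0" and "\<bar>\<beta>\<bar> < 1 / 4" and "cA > 0" and "cZ > 0"
  shows "\<exists>\<delta> > 0. \<exists>\<epsilon> > 0.
    \<forall>(d :: nat \<Rightarrow> nat) (A :: nat \<Rightarrow> nat \<Rightarrow> nat \<Rightarrow> real) (Z :: nat \<Rightarrow> nat \<Rightarrow> nat \<Rightarrow> real)
      (\<theta> :: nat \<Rightarrow> nat \<Rightarrow> real) (est :: nat \<Rightarrow> (nat \<Rightarrow> real) \<Rightarrow> real \<times> (nat \<Rightarrow> real)).
      (\<forall>N. supported (d N) (\<theta> N)) \<longrightarrow>
      (\<forall>N. \<forall>k < d N. \<bar>\<theta> N k\<bar> < \<Theta>) \<longrightarrow>
      (\<forall>N. \<forall>i < N. \<forall>k < d N. \<bar>Z N i k\<bar> < M) \<longrightarrow>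
      (\<forall>N. \<forall>i < N. \<forall>j < N. A N i j = A N j i) \<longrightarrow>
      (\<forall>N. \<forall>i < N. A N i i = 0) \<longrightarrow>
      (\<forall>N. \<forall>i < N. (\<Sum>j<N. \<bar>A N i j\<bar>) \<le> 1) \<longrightarrow>
      (\<forall>\<^sub>F N in sequentially. (\<Sum>i<N. \<Sum>j<N. (A N i j)\<^sup>2) / real N \<ge> cA) \<longrightarrow>
      (\<forall>\<^sub>F N in sequentially. \<forall>ev. eigenvalue (gram N (d N) (Z N)) ev \<longrightarrow> ev \<ge> cZ) \<longrightarrow>
      (\<forall>N. l0_norm (d N) \<beta> (\<theta> N) \<le> s0) \<longrightarrow>
      filterlim d at_top sequentially \<longrightarrow>
      (\<forall>\<^sub>F N in sequentially. (real (d N))\<^sup>2 * ln (real (d N)) \<le> \<epsilon> * real N) \<longrightarrow>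
      (\<forall>N. \<forall>x \<in> spins N.
         is_pl_minimizer N (d N) (A N) (Z N) (\<delta> * sqrt (ln (real (d N) + 1) / real N)) x (est N x)) \<longrightarrow>
      (\<exists>C. (\<lambda>N. ising_prob N (d N) (A N) (Z N) \<beta> (\<theta> N)
               {x. l2_dist (d N) (est N x) \<beta> (\<theta> N) \<le> C * sqrt (ln (real (d N)) / real N)})
             \<longlonglongrightarrow> 1)"
proof -
  define K where "K = 1 + real s0 * (\<Theta> * M)"
  \<comment> \<open>This \<open>\<delta>\<close> makes each of the \<open>2 d + 2\<close> tail bounds behind \<open>good\<close> equal to \<open>2 / (d + 1)\<^sup>2\<close>.\<close>
  define B where "B = 16 * (M + 2) * (M + 1)"
  define \<delta> where "\<delta> = sqrt (8 * B)"
  define q where "q = 1 + sqrt (real s0)"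
  define c1 where "c1 = (1 - tanh K) * cA"
  define c2 where "c2 = (1 - (tanh (K + 1))\<^sup>2) / 2"
  define \<kappa> where "\<kappa> = 2 * (1 / sqrt cZ + (1 + 1 / sqrt cZ) * (4 / c1))"
  \<comment> \<open>The constant of \<open>estimator_error\<close> times the factor of
    \<open>lam\<close>; \<open>sqrt 2\<close> pays for replacing \<open>ln (d + 1)\<close> by
    \<open>2 * ln d\<close>.\<close>
  define C where "C = 4 * q * \<kappa>\<^sup>2 / c2 * (\<delta> * sqrt 2)"
  have B: "B > 0" using \<open>M > 0\<close> by (simp add: B_def)
  then have \<delta>: "\<delta> > 0" "\<delta>\<^sup>2 = 8 * B" by (simp_all add: \<delta>_def)
  have c1: "c1 > 0"
    unfolding c1_def using \<open>cA > 0\<close> tanh_real_bounds[of K] by simp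
  have c2: "c2 > 0"
  proof -
    have "\<bar>tanh (K + 1)\<bar> < 1" using tanh_real_bounds[of "K + 1"] by auto
    then show ?thesis by (simp add: c2_def abs_square_less_1 del: tanh_real_abs)
  qed
  have \<kappa>: "\<kappa> > 0"
    unfolding \<kappa>_def using c1 \<open>cZ > 0\<close> by (intro mult_pos_pos add_pos_pos) auto
  have q: "q \<ge> 1" by (simp add: q_def)
  \<comment> \<open>The growth condition appears with factor 1, the witness for \<epsilon>. This
    suffices because \<open>d\<close> tends to infinity: the condition bounds \<open>lam\<close> by
    a multiple of \<open>1 / d\<close>, so all smallness conditions hold eventually.\<close>
  have main: "\<exists>C. (\<lambda>N. ising_prob N (d N) (A N) (Z N) \<beta> (\<theta> N)
               {x. l2_dist (d N) (est N x) \<beta> (\<theta> N) \<le> C * sqrt (ln (real (d N)) / real N)})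
             \<longlonglongrightarrow> 1"
    if sup: "\<forall>N. supported (d N) (\<theta> N)"
      and \<theta>: "\<forall>N. \<forall>k < d N. \<bar>\<theta> N k\<bar> < \<Theta>"
      and Z: "\<forall>N. \<forall>i < N. \<forall>k < d N. \<bar>Z N i k\<bar> < M"
      and sym: "\<forall>N. \<forall>i < N. \<forall>j < N. A N i j = A N j i"
      and diag: "\<forall>N. \<forall>i < N. A N i i = 0"
      and row: "\<forall>N. \<forall>i < N. (\<Sum>j<N. \<bar>A N i j\<bar>) \<le> 1"
      and frob: "\<forall>\<^sub>F N in sequentially. (\<Sum>i<N. \<Sum>j<N. (A N i j)\<^sup>2) / real N \<ge> cA"
      and eig: "\<forall>\<^sub>F N in sequentially. \<forall>ev. eigenvalue (gram N (d N) (Z N)) ev \<longrightarrow> ev \<ge> cZ"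
      and l0: "\<forall>N. l0_norm (d N) \<beta> (\<theta> N) \<le> s0"
      and dlim: "filterlim d at_top sequentially"
      and growth: "\<forall>\<^sub>F N in sequentially. (real (d N))\<^sup>2 * ln (real (d N)) \<le> 1 * real N"
      and min: "\<forall>N. \<forall>x \<in> spins N.
         is_pl_minimizer N (d N) (A N) (Z N) (\<delta> * sqrt (ln (real (d N) + 1) / real N)) x (est N x)"
    for d A Z \<theta> est
  proof
    define lam where "lam = (\<lambda>N. \<delta> * sqrt (ln (real (d N) + 1) / real N))"
    define P where "P = (\<lambda>N. ising_prob N (d N) (A N) (Z N) \<beta> (\<theta> N)
               {x. l2_dist (d N) (est N x) \<beta> (\<theta> N) \<le> C * sqrt (ln (real (d N)) / real N)})"
    have d2: "\<forall>\<^sub>F N in sequentially. d N \<ge> 2"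
      using dlim by (simp add: filterlim_at_top)
    have dreal: "filterlim (\<lambda>N. real (d N)) at_top sequentially"
      by (rule filterlim_compose[OF filterlim_real_sequentially dlim])
    have lam_lim: "lam \<longlonglongrightarrow> 0"
    proof (rule tendsto_sandwich[of "\<lambda>_. 0"])
      show "\<forall>\<^sub>F N in sequentially. 0 \<le> lam N"
        using \<delta> by (simp add: lam_def)
      show "\<forall>\<^sub>F N in sequentially. lam N \<le> \<delta> * sqrt 2 / real (d N)"
        using d2 growth eventually_gt_at_top[of 0]
      proof eventually_elim
        case (elim N)
        then have d: "real (d N) > 0" "real N > 0" by auto
        have "(real (d N))\<^sup>2 * ln (real (d N) + 1) \<le> (real (d N))\<^sup>2 * (2 * ln (real (d N)))"
          using ln_Suc_le_double_ln[OF elim(1)] by (intro mult_left_mono) auto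
        also have "\<dots> \<le> 2 * real N" using elim(2) by simp
        finally have "ln (real (d N) + 1) / real N \<le> 2 / (real (d N))\<^sup>2"
          using d by (simp add: field_simps)
        then have "sqrt (ln (real (d N) + 1) / real N) \<le> sqrt (2 / (real (d N))\<^sup>2)"
          by (rule real_sqrt_le_mono)
        also have "\<dots> = sqrt 2 / real (d N)"
          by (simp add: real_sqrt_divide)
        finally have "lam N \<le> \<delta> * (sqrt 2 / real (d N))"
          unfolding lam_def using \<delta> by (intro mult_left_mono) auto
        then show ?case by simp
      qed
      show "(\<lambda>N. \<delta> * sqrt 2 / real (d N)) \<longlonglongrightarrow> 0"
        by (rule real_tendsto_divide_at_top[OF tendsto_const dreal])
    qed simp
    have small1: "\<forall>\<^sub>F N in sequentially. lam N < c1"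
      using lam_lim c1 by (rule order_tendstoD)
    have small2: "\<forall>\<^sub>F N in sequentially. (1 + 1 / sqrt cZ) * (lam N * (4 * q) / c1) < 1 / 2"
    proof (rule order_tendstoD)
      show "(\<lambda>N. (1 + 1 / sqrt cZ) * (lam N * (4 * q) / c1)) \<longlonglongrightarrow> 0"
        by (auto intro!: tendsto_eq_intros lam_lim simp: c1[THEN less_imp_neq, symmetric])
    qed simp
    have small3: "\<forall>\<^sub>F N in sequentially. 2 * lam N * q * ((1 + M) * (4 * q)) < c2 / (2 * \<kappa>\<^sup>2)"
    proof (rule order_tendstoD)
      show "(\<lambda>N. 2 * lam N * q * ((1 + M) * (4 * q))) \<longlonglongrightarrow> 0"
        by (auto intro!: tendsto_eq_intros lam_lim)
      show "0 < c2 / (2 * \<kappa>\<^sup>2)" using c2 \<kappa> by simp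
    qed
    \<comment> \<open>The locale predicate takes three arguments because its assumptions mention
      only \<open>N\<close>, \<open>A\<close> and \<beta>; the other parameters are supplied at the
      interpretation.\<close>
    have ising: "ising N (A N) \<beta>" for N
      using sym diag row assms(3) by unfold_locales auto
    have upper: "P N \<le> 1" for N
      unfolding P_def by (rule ising.prob_le_1[OF ising])
    have lower: "\<forall>\<^sub>F N in sequentially. 1 - 4 / (real (d N) + 1) \<le> P N"
      using d2 frob eig small1 small2 small3 eventually_gt_at_top[of 0]
    proof eventually_elim
      case (elim N)
      interpret ising N "d N" "A N" "Z N" \<beta> "\<theta> N" by (rule ising)
      have N: "N > 0" "real N > 0" using elim by auto
      have ln_pos: "ln (real (d N) + 1) > 0" using elim(1) by simp
      have lam: "lam N > 0" unfolding lam_def using \<delta> N ln_pos by simp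
      have card: "card {k. k < d N \<and> \<theta> N k \<noteq> 0} \<le> s0"
        using l0[rule_format, of N] by (simp add: l0_norm_def)
      have gram: "cZ * real N * (\<Sum>k<d N. (v k)\<^sup>2) \<le> (\<Sum>i<N. (\<Sum>k<d N. v k * Z N i k)\<^sup>2)" for v
        by (rule gram_form_ge) (use elim N in auto)
      have F: "cA * real N \<le> (\<Sum>i<N. \<Sum>j<N. (A N i j)\<^sup>2)"
        using elim(2) N by (simp add: pos_le_divide_eq)
      have close: "l2_dist (d N) (est N x) \<beta> (\<theta> N) \<le> C * sqrt (ln (real (d N)) / real N)"
        if x: "x \<in> spins N" "x \<in> good (real N * lam N / 2)" for x
      proof -
        have "l2_dist (d N) (est N x) \<beta> (\<theta> N) \<le> 4 * q * \<kappa>\<^sup>2 / c2 * lam N"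
          unfolding q_def \<kappa>_def c2_def c1_def
        proof (rule estimator_error[where M = M])
          show "\<bar>field x i\<bar> \<le> K" if "i < N" for i
            unfolding K_def
            by (rule field_abs_le) (use x that \<theta> Z card assms in \<open>auto intro: less_imp_le\<close>)
          show "is_pl_minimizer N (d N) (A N) (Z N) (lam N) x (est N x)"
            unfolding lam_def using min x by blast
        qed (use x N lam F gram card sup Z assms elim in
             \<open>auto simp: q_def \<kappa>_def c2_def c1_def intro: less_imp_le\<close>)
        also have "lam N \<le> \<delta> * sqrt 2 * sqrt (ln (real (d N)) / real N)"
        proof -
          have "ln (real (d N) + 1) / real N \<le> 2 * (ln (real (d N)) / real N)"
            using ln_Suc_le_double_ln[OF elim(1)] N by (simp add: divide_right_mono)
          then have "sqrt (ln (real (d N) + 1) / real N) \<le> sqrt (2 * (ln (real (d N)) / real N))"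
            by (rule real_sqrt_le_mono)
          then show ?thesis
            unfolding lam_def mult.assoc real_sqrt_mult using \<delta> by (intro mult_left_mono) auto
        qed
        then have "4 * q * \<kappa>\<^sup>2 / c2 * lam N
            \<le> 4 * q * \<kappa>\<^sup>2 / c2 * (\<delta> * sqrt 2 * sqrt (ln (real (d N)) / real N))"
          using q c2 by (intro mult_left_mono) auto
        finally show ?thesis by (simp add: C_def)
      qed
      \<comment> \<open>With \<open>u = real N * lam N / 2\<close> the tail exponent equals
        \<open>2 * ln (d + 1)\<close>, so the union bound of size \<open>4 * (d + 1)\<close> leaves
        the failure probability \<open>4 / (d + 1)\<close>.\<close>
      have "1 - 4 / (real (d N) + 1) = 1 - 4 * (real (d N) + 1) * exp (- (2 * ln (real (d N) + 1)))"
      proof -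
        have e: "exp (- (2 * ln (real (d N) + 1))) = 1 / (real (d N) + 1)\<^sup>2"
          by (simp add: exp_minus exp_double field_simps)
        have "4 / y = 4 * y * (1 / y\<^sup>2)" if "y > 0" for y :: real
          using that by (simp add: power2_eq_square)
        then show ?thesis unfolding e by simp
      qed
      also have "2 * ln (real (d N) + 1) = (real N * lam N / 2)\<^sup>2 / (B * real N)"
      proof -
        have "(lam N)\<^sup>2 = 8 * B * (ln (real (d N) + 1) / real N)"
          unfolding lam_def power_mult_distrib \<delta> using ln_pos N by simp
        then have "2 * ln (real (d N) + 1) = real N * (lam N)\<^sup>2 / (4 * B)"
          using N B by simp
        also have "\<dots> = (real N * lam N / 2)\<^sup>2 / (B * real N)"
          using N by (simp add: power2_eq_square)
        finally show ?thesis .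
      qed
      also have "1 - 4 * (real (d N) + 1) * exp (- ((real N * lam N / 2)\<^sup>2 / (B * real N)))
          \<le> prob (good (real N * lam N / 2))"
        unfolding B_def
        using prob_good_ge[of M "real N * lam N / 2"] Z N lam assms by (simp add: less_imp_le)
      also have "\<dots> \<le> P N"
        unfolding P_def by (rule prob_mono) (use close in auto)
      finally show ?case .
    qed
    have "filterlim (\<lambda>N. real (d N) + 1) at_top sequentially"
      by (rule filterlim_at_top_mono[OF dreal]) simp
    then have "(\<lambda>N. 1 - 4 / (real (d N) + 1)) \<longlonglongrightarrow> 1 - 0"
      by (intro tendsto_diff tendsto_const real_tendsto_divide_at_top[OF tendsto_const])
    then have "P \<longlonglongrightarrow> 1"
      using lower upper by (intro tendsto_sandwich[of "\<lambda>N. 1 - 4 / (real (d N) + 1)" P _ "\<lambda>_. 1"]) auto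
    then show "(\<lambda>N. ising_prob N (d N) (A N) (Z N) \<beta> (\<theta> N)
               {x. l2_dist (d N) (est N x) \<beta> (\<theta> N) \<le> C * sqrt (ln (real (d N)) / real N)})
             \<longlonglongrightarrow> 1"
      by (simp add: P_def)
  qed
  show ?thesis
    by (rule exI[of _ \<delta>], rule conjI[OF \<delta>(1)], rule exI[of _ 1], rule conjI, rule less_numeral_extra(1),
        intro allI impI, rule main) assumption+
qed

end
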